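(* For any language $L$ over the binary alphabet $\{0,1\}$, there exists a bounded-error public-coin interactive proof system for $L$ in which the messages are classical, the verifier is a 2qcfa with two quantum bits (four quantum basis states), and the expected runtime for inputs of length $n$ is $2^{2^{O(n)}}$.
   Context: A two-way finite automaton with quantum and classical states (2qcfa) has a finite set of classical states (with designated initial, accepting and rejecting states), a quantum register with a finite set of quantum basis states and a designated initial quantum state, and a read-only input tape holding the input between a left and a right end-marker, scanned by a two-way head. In each step a superoperator $\mathcal{E}=\{E_1,\dots,E_k\}$ (finitely many square matrices with $\sum_i E_i^\dagger E_i=I$) is applied to the quantum register in state $|\psi\rangle$, yielding outcome $i$ with probability $p_i=\|E_i|\psi\rangle\|^2$ and new state $E_i|\psi\rangle/\sqrt{p_i}$; then the next classical state and head move are determined classically. Transition amplitudes (entries of the operation elements) may be arbitrary real numbers, possibly uncomputable. In a public-coin interactive proof system with a 2qcfa verifier, a prover sends, at each step, a symbol from a finite communication alphabet; the superoperator applied by the verifier is determined by its current classical state, the scanned input symbol and the current communication symbol, and the next classical state and head move are determined by these together with the observed outcome. All outcomes of the verifier's superoperators are immediately visible to the prover, whose messages may be an arbitrary function of the input and the history of outcomes. The system recognizes $L$ with bounded error if there is $\epsilon<1/2$ such that for every $w\in L$ some prover makes the verifier accept $w$ with probability at least $1-\epsilon$, and for every $w\notin L$ the verifier rejects $w$ with probability at least $1-\epsilon$ against every prover. *)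

theory Defs
  imports "HOL-Analysis.Analysis" "HOL-Library.Landau_Symbols"
begin

datatype 'a tape_symbol = Left_End | Input 'a | Right_End

datatype head_move = Move_Left | Stay | Move_Right

definition tape :: "'a list \<Rightarrow> nat \<Rightarrow> 'a tape_symbol" where
  "tape w p = (if p = 0 then Left_End
               else if p \<le> length w then Input (w ! (p - 1))
               else Right_End)"

fun move_head :: "head_move \<Rightarrow> nat \<Rightarrow> nat" where
  "move_head Move_Left p = p - 1"
| "move_head Stay p = p"
| "move_head Move_Right p = p + 1"

text \<open>The matrices have real entries, so the adjoint is the transpose; a register that starts in a
  basis state keeps real amplitudes. Outcomes are the indices of the list.\<close>

definition superoperator :: "(real^'q^'q) list \<Rightarrow> bool" where
  "superoperator Es \<longleftrightarrow> (\<Sum>E\<leftarrow>Es. transpose E ** E) = mat 1"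

text \<open>Type parameters: classical states, communication symbols, input symbols, quantum basis states.
  The transition function takes the state, the scanned symbol, the communication symbol and the
  observed outcome.\<close>

record ('s, 'c, 'a, 'q) verifier =
  states :: "'s set"
  init_state :: 's
  acc_state :: 's
  rej_state :: 's
  comm_alphabet :: "'c set"
  init_basis :: 'q
  superop :: "'s \<Rightarrow> 'a tape_symbol \<Rightarrow> 'c \<Rightarrow> (real^'q^'q) list"
  transition :: "'s \<Rightarrow> 'a tape_symbol \<Rightarrow> 'c \<Rightarrow> nat \<Rightarrow> 's \<times> head_move"

definition halting_state :: "('s, 'c, 'a, 'q::finite) verifier \<Rightarrow> 's \<Rightarrow> bool" where
  "halting_state V s \<longleftrightarrow> s = acc_state V \<or> s = rej_state V"

definition twoway_qcfa_verifier :: "('s, 'c, 'a, 'q::finite) verifier \<Rightarrow> bool" where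
  "twoway_qcfa_verifier V \<longleftrightarrow>
     finite (states V) \<and> init_state V \<in> states V \<and>
     acc_state V \<in> states V \<and> rej_state V \<in> states V \<and> acc_state V \<noteq> rej_state V \<and>
     finite (comm_alphabet V) \<and> comm_alphabet V \<noteq> {} \<and>
     (\<forall>s \<in> states V. \<not> halting_state V s \<longrightarrow> (\<forall>x. \<forall>c \<in> comm_alphabet V.
        superoperator (superop V s x c) \<and>
        (\<forall>i < length (superop V s x c). \<forall>s' d. transition V s x c i = (s', d) \<longrightarrow>
           s' \<in> states V \<and>
           (x = Left_End \<longrightarrow> d \<noteq> Move_Left) \<and> (x = Right_End \<longrightarrow> d \<noteq> Move_Right))))"

text \<open>A configuration consists of the classical state, the head position and the normalised state of
  the quantum register.\<close>

type_synonym ('s, 'q) config = "'s \<times> nat \<times> (real^'q)"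

definition init_config :: "('s, 'c, 'a, 'q::finite) verifier \<Rightarrow> ('s, 'q) config" where
  "init_config V = (init_state V, 0, axis (init_basis V) 1)"

fun outcome_prob ::
  "('s, 'c, 'a, 'q::finite) verifier \<Rightarrow> 'a list \<Rightarrow> 'c \<Rightarrow> ('s, 'q) config \<Rightarrow> nat \<Rightarrow> real" where
  "outcome_prob V w c (s, p, \<psi>) i =
     (let Es = superop V s (tape w p) c in
      if i < length Es then (norm (Es ! i *v \<psi>))\<^sup>2 else 0)"

fun next_config ::
  "('s, 'c, 'a, 'q::finite) verifier \<Rightarrow> 'a list \<Rightarrow> 'c \<Rightarrow> ('s, 'q) config \<Rightarrow> nat \<Rightarrow> ('s, 'q) config" where
  "next_config V w c (s, p, \<psi>) i =
     (let \<phi> = superop V s (tape w p) c ! i *v \<psi>;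
          (s', d) = transition V s (tape w p) c i
      in (s', move_head d p, \<phi> /\<^sub>R norm \<phi>))"

text \<open>A prover maps the input and the history of outcomes to the next communication symbol.
  Histories list the most recent outcome first.\<close>

type_synonym ('a, 'c) prover = "'a list \<Rightarrow> nat list \<Rightarrow> 'c"

definition prover_for :: "('s, 'c, 'a, 'q::finite) verifier \<Rightarrow> ('a, 'c) prover \<Rightarrow> bool" where
  "prover_for V P \<longleftrightarrow> (\<forall>w h. P w h \<in> comm_alphabet V)"

primrec config_after ::
  "('s, 'c, 'a, 'q::finite) verifier \<Rightarrow> ('a, 'c) prover \<Rightarrow> 'a list \<Rightarrow> nat list \<Rightarrow> ('s, 'q) config" where
  "config_after V P w [] = init_config V"
| "config_after V P w (i # h) = next_config V w (P w h) (config_after V P w h) i"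

abbreviation state_after ::
  "('s, 'c, 'a, 'q::finite) verifier \<Rightarrow> ('a, 'c) prover \<Rightarrow> 'a list \<Rightarrow> nat list \<Rightarrow> 's" where
  "state_after V P w h \<equiv> fst (config_after V P w h)"

text \<open>The probability that the verifier makes at least \<open>length h\<close> steps, with outcomes \<open>h\<close>. It is zero
  if a proper initial part of \<open>h\<close> already leads to a halting state, so distinct halting histories
  describe disjoint events.\<close>

primrec history_prob ::
  "('s, 'c, 'a, 'q::finite) verifier \<Rightarrow> ('a, 'c) prover \<Rightarrow> 'a list \<Rightarrow> nat list \<Rightarrow> real" where
  "history_prob V P w [] = 1"
| "history_prob V P w (i # h) =
     (if halting_state V (state_after V P w h) then 0
      else history_prob V P w h * outcome_prob V w (P w h) (config_after V P w h) i)"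

definition accept_prob ::
  "('s, 'c, 'a, 'q::finite) verifier \<Rightarrow> ('a, 'c) prover \<Rightarrow> 'a list \<Rightarrow> ennreal" where
  "accept_prob V P w =
     (\<Sum>\<^sub>\<infinity>h | state_after V P w h = acc_state V. ennreal (history_prob V P w h))"

definition reject_prob ::
  "('s, 'c, 'a, 'q::finite) verifier \<Rightarrow> ('a, 'c) prover \<Rightarrow> 'a list \<Rightarrow> ennreal" where
  "reject_prob V P w =
     (\<Sum>\<^sub>\<infinity>h | state_after V P w h = rej_state V. ennreal (history_prob V P w h))"

text \<open>The expectation of the number of steps before halting, which is infinite for a
  non-halting computation.\<close>

definition expected_runtime ::
  "('s, 'c, 'a, 'q::finite) verifier \<Rightarrow> ('a, 'c) prover \<Rightarrow> 'a list \<Rightarrow> ennreal" where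
  "expected_runtime V P w =
     (if accept_prob V P w + reject_prob V P w = 1
      then \<Sum>\<^sub>\<infinity>h | halting_state V (state_after V P w h).
             of_nat (length h) * ennreal (history_prob V P w h)
      else \<infinity>)"

definition recognizes_with_bounded_error ::
  "('s, 'c, 'a, 'q::finite) verifier \<Rightarrow> 'a list set \<Rightarrow> bool" where
  "recognizes_with_bounded_error V L \<longleftrightarrow>
     (\<exists>\<epsilon>::real. 0 \<le> \<epsilon> \<and> \<epsilon> < 1/2 \<and>
        (\<forall>w \<in> L. \<exists>P. prover_for V P \<and> accept_prob V P w \<ge> ennreal (1 - \<epsilon>)) \<and>
        (\<forall>w. w \<notin> L \<longrightarrow> (\<forall>P. prover_for V P \<longrightarrow> reject_prob V P w \<ge> ennreal (1 - \<epsilon>))))"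

end

theory Submission
  imports Defs
begin

text \<open>Number the words so that \<open>w\<close> gets the integer with binary expansion \<open>1w\<close>, and encode \<open>L\<close> by the
  real whose base-4 digits are the membership bits. In pass \<open>j\<close> over the input the prover sends the
  binary digits of \<open>j\<close> and the \<open>j\<close>-th membership bit. The verifier compares the former with \<open>1w\<close>
  classically; in the register, which up to a known factor holds a vector of \<open>\<real>\<^sup>4\<close> evolving
  linearly, it keeps its own pass counter, the number just received, and the shifted encoding. A wrong
  number shows up as a difference of at least 1 between two amplitudes and may be rejected at once; a
  wrong membership bit drives the shifted encoding out of \<open>[0, 1/3]\<close>, which is tested in the pass
  whose number is \<open>1w\<close>. There the odds of the right answer against the wrong one are bounded below.

  The linear maps are made contractions by scaling, and the lost probability restarts the protocol.
  Hence a round is short on average, but it reaches a decision only with doubly exponentially small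
  probability. No prover can avoid this: the numbers have as many digits as \<open>1w\<close>, so without a lie,
  which would be noticed, pass \<open>1w\<close> is reached after boundedly many steps.\<close>

section \<open>Halting times and acceptance probabilities\<close>

locale verifier_run =
  fixes V :: "('s, 'c, 'a, 'q::finite) verifier" and P :: "('a, 'c) prover" and w :: "'a list"
    and K :: nat
  assumes qcfa: "twoway_qcfa_verifier V"
    and prover: "prover_for V P"
    and outcomes: "length (superop V s x c) \<le> K"
begin

section \<open>Unnormalised register states and the probabilities of histories\<close>

abbreviation state :: "nat list \<Rightarrow> 's" where
  "state h \<equiv> state_after V P w h"

definition pos :: "nat list \<Rightarrow> nat" where
  "pos h = fst (snd (config_after V P w h))"

abbreviation halted :: "nat list \<Rightarrow> bool" where
  "halted h \<equiv> halting_state V (state h)"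

abbreviation ops :: "nat list \<Rightarrow> (real^'q^'q) list" where
  "ops h \<equiv> superop V (state h) (tape w (pos h)) (P w h)"

text \<open>Without normalisation the register evolves linearly along a history. Continuations past
  a halt or with an invalid outcome get the zero vector.\<close>

primrec amp :: "nat list \<Rightarrow> real^'q" where
  "amp [] = axis (init_basis V) 1"
| "amp (i # h) = (if halted h \<or> length (ops h) \<le> i then 0 else ops h ! i *v amp h)"

lemma config_after_eq: "config_after V P w h = (state h, pos h, snd (snd (config_after V P w h)))"
  by (simp add: pos_def)

lemma state_Cons: "state (i # h) = fst (transition V (state h) (tape w (pos h)) (P w h) i)"
  by (subst (1) config_after.simps, subst config_after_eq)
    (simp add: Let_def split: prod.split)

lemma pos_Cons: "pos (i # h) =
    move_head (snd (transition V (state h) (tape w (pos h)) (P w h) i)) (pos h)"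
  by (subst pos_def, subst (1) config_after.simps, subst config_after_eq)
    (simp add: Let_def split: prod.split)

lemma state_Nil: "state [] = init_state V" and pos_Nil: "pos [] = 0"
  by (simp_all add: init_config_def pos_def)

text \<open>By linearity the norms divided out at the successive steps multiply up to
  \<open>norm (amp h)\<close>, whose square is the product of the outcome probabilities.\<close>

lemma amp_normalised:
  "amp h = norm (amp h) *\<^sub>R snd (snd (config_after V P w h)) \<or> history_prob V P w h = 0"
  "history_prob V P w h = (norm (amp h))\<^sup>2"
proof (induction h)
  case Nil
  show "amp [] = norm (amp []) *\<^sub>R snd (snd (config_after V P w [])) \<or> history_prob V P w [] = 0"
    "history_prob V P w [] = (norm (amp []))\<^sup>2"
    by (simp_all add: init_config_def)
next
  case (Cons i h)
  define \<psi> where "\<psi> = snd (snd (config_after V P w h))"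
  have amp_h: "amp h = norm (amp h) *\<^sub>R \<psi>"
    using Cons by (auto simp: \<psi>_def)
  have conf: "config_after V P w h = (state h, pos h, \<psi>)"
    by (simp add: pos_def \<psi>_def)
  define \<phi> where "\<phi> = ops h ! i *v \<psi>"
  have \<phi>: "ops h ! i *v amp h = norm (amp h) *\<^sub>R \<phi>"
    by (subst amp_h) (simp add: \<phi>_def matrix_vector_mult_scaleR)
  have next_state: "snd (snd (config_after V P w (i # h))) = \<phi> /\<^sub>R norm \<phi>"
    by (subst config_after.simps, subst conf) (simp add: \<phi>_def Let_def split: prod.split)
  have prob: "outcome_prob V w (P w h) (config_after V P w h) i =
      (if i < length (ops h) then (norm \<phi>)\<^sup>2 else 0)"
    by (subst conf) (simp add: \<phi>_def Let_def)
  show "history_prob V P w (i # h) = (norm (amp (i # h)))\<^sup>2"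
    unfolding history_prob.simps prob
    using Cons.IH(2) by (auto simp: \<phi> power_mult_distrib)
  show "amp (i # h) = norm (amp (i # h)) *\<^sub>R snd (snd (config_after V P w (i # h))) \<or>
      history_prob V P w (i # h) = 0"
    unfolding next_state by (auto simp: \<phi>)
qed

lemma state_in_states: "amp h \<noteq> 0 \<Longrightarrow> state h \<in> states V"
proof (induction h)
  case Nil
  then show ?case using qcfa by (simp add: init_config_def twoway_qcfa_verifier_def)
next
  case (Cons i h)
  then have *: "\<not> halted h" "i < length (ops h)" "amp h \<noteq> 0"
    by (auto split: if_splits)
  obtain s' d where t: "transition V (state h) (tape w (pos h)) (P w h) i = (s', d)"
    by fastforce
  have "P w h \<in> comm_alphabet V" using prover by (simp add: prover_for_def)
  then have "s' \<in> states V"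
    using qcfa * Cons.IH t unfolding twoway_qcfa_verifier_def by blast
  then show ?case by (simp add: state_Cons t del: config_after.simps)
qed

lemma sum_list_norm_matrix_vector:
  fixes Es :: "(real^'q^'q) list"
  shows "(\<Sum>E\<leftarrow>Es. (norm (E *v v))\<^sup>2) = v \<bullet> ((\<Sum>E\<leftarrow>Es. transpose E ** E) *v v)"
proof (induction Es)
  case (Cons E Es)
  have "(norm (E *v v))\<^sup>2 = ((E *v v) v* E) \<bullet> v"
    by (simp add: power2_norm_eq_inner dot_lmul_matrix)
  also have "\<dots> = v \<bullet> ((transpose E ** E) *v v)"
    by (simp add: inner_commute transpose_matrix_vector flip: matrix_vector_mul_assoc)
  finally have "(norm (E *v v))\<^sup>2 = v \<bullet> ((transpose E ** E) *v v)" .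
  then show ?case
    by (simp add: Cons.IH matrix_vector_mult_add_rdistrib inner_add_right)
qed simp

text \<open>Conservation of mass: the superoperator condition covers the valid outcomes, and the
  padding up to \<open>K\<close> consists of zero vectors.\<close>

lemma sum_amp_Cons:
  assumes "\<not> halted h"
  shows "(\<Sum>i<K. (norm (amp (i # h)))\<^sup>2) = (norm (amp h))\<^sup>2"
proof (cases "amp h = 0")
  case True
  then have "amp (i # h) = 0" for i by simp
  then show ?thesis using True by (simp del: amp.simps)
next
  case False
  have "P w h \<in> comm_alphabet V" using prover by (simp add: prover_for_def)
  then have so: "superoperator (ops h)"
    using qcfa state_in_states[OF False] assms unfolding twoway_qcfa_verifier_def by blast
  have "(\<Sum>i<K. (norm (amp (i # h)))\<^sup>2) = (\<Sum>i<length (ops h). (norm (amp (i # h)))\<^sup>2)"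
    by (rule sum.mono_neutral_right) (use outcomes in auto)
  also have "\<dots> = (\<Sum>i<length (ops h). (norm (ops h ! i *v amp h))\<^sup>2)"
    using assms by simp
  also have "\<dots> = (\<Sum>E\<leftarrow>ops h. (norm (E *v amp h))\<^sup>2)"
    by (simp add: sum_list_sum_nth atLeast0LessThan)
  also have "\<dots> = (norm (amp h))\<^sup>2"
    using so unfolding sum_list_norm_matrix_vector superoperator_def
    by (simp add: power2_norm_eq_inner)
  finally show ?thesis .
qed

section \<open>Mass that survives or halts in the tree of histories\<close>

primrec over_extensions :: "(nat list \<Rightarrow> real) \<Rightarrow> nat \<Rightarrow> nat list \<Rightarrow> real" where
  "over_extensions f 0 h = f h"
| "over_extensions f (Suc m) h = (\<Sum>i<K. over_extensions f m (i # h))"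

text \<open>Peels off the last outcome instead of the first; the most recent outcome is the head of
  a history, so this fits the enumeration of lists.\<close>

lemma over_extensions_Suc:
  "over_extensions f (Suc m) h = over_extensions (\<lambda>h. \<Sum>i<K. f (i # h)) m h"
  by (induction m arbitrary: h) auto

lemma over_extensions_Nil:
  "over_extensions f m [] = sum f {h. set h \<subseteq> {..<K} \<and> length h = m}"
proof (induction m arbitrary: f)
  case 0
  have "{h :: nat list. set h \<subseteq> {..<K} \<and> length h = 0} = {[]}" by auto
  then show ?case by simp
next
  case (Suc m)
  let ?L = "\<lambda>m. {h. set h \<subseteq> {..<K} \<and> length h = m}"
  have "sum f (?L (Suc m)) = (\<Sum>(h, i) \<in> ?L m \<times> {..<K}. f (i # h))"
    by (rule sum.reindex_bij_witness[where i = "\<lambda>(h, i). i # h" and j = "\<lambda>h. (tl h, hd h)"])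
      (auto simp: length_Suc_conv)
  also have "\<dots> = (\<Sum>h \<in> ?L m. \<Sum>i<K. f (i # h))"
    by (simp add: sum.cartesian_product)
  also have "\<dots> = over_extensions f (Suc m) []"
    by (simp only: Suc.IH[symmetric] over_extensions_Suc)
  finally show ?case by simp
qed

text \<open>Masses are absolute rather than conditional on \<open>h\<close>, so that they add up
  over outcomes. As \<open>amp\<close> vanishes beyond a halt, \<open>halt_at m\<close> counts only
  halts exactly \<open>m\<close> steps after \<open>h\<close>.\<close>

definition survive :: "nat \<Rightarrow> nat list \<Rightarrow> real" where
  "survive = over_extensions (\<lambda>h. if halted h then 0 else (norm (amp h))\<^sup>2)"

definition halt_at :: "nat \<Rightarrow> nat list \<Rightarrow> real" where
  "halt_at = over_extensions (\<lambda>h. if halted h then (norm (amp h))\<^sup>2 else 0)"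

definition halt_within :: "nat \<Rightarrow> nat list \<Rightarrow> real" where
  "halt_within m h = (norm (amp h))\<^sup>2 - survive m h"

lemma survive_Suc: "survive (Suc m) h = (\<Sum>i<K. survive m (i # h))"
  by (simp add: survive_def)

lemma over_extensions_nonneg: "(\<And>h. 0 \<le> f h) \<Longrightarrow> 0 \<le> over_extensions f m h"
  by (induction m arbitrary: h) (auto intro: sum_nonneg)

lemma survive_nonneg: "0 \<le> survive m h" and halt_at_nonneg: "0 \<le> halt_at m h"
  by (auto simp: survive_def halt_at_def intro!: over_extensions_nonneg)

lemma halt_at_plus_survive: "halt_at (Suc m) h + survive (Suc m) h = survive m h"
proof (induction m arbitrary: h)
  case 0
  have "halt_at (Suc 0) h + survive (Suc 0) h = (\<Sum>i<K. (norm (amp (i # h)))\<^sup>2)"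
    by (simp add: halt_at_def survive_def flip: sum.distrib del: amp.simps config_after.simps)
      (rule sum.cong, auto)
  also have "\<dots> = survive 0 h"
    using sum_amp_Cons[of h] by (cases "halted h") (simp_all add: survive_def)
  finally show ?case .
next
  case (Suc m)
  have "halt_at (Suc (Suc m)) h + survive (Suc (Suc m)) h =
      (\<Sum>i<K. halt_at (Suc m) (i # h) + survive (Suc m) (i # h))"
    by (simp add: halt_at_def survive_def flip: sum.distrib)
  also have "\<dots> = survive (Suc m) h"
    unfolding Suc by (simp only: survive_Suc)
  finally show ?case .
qed

lemma survive_antimono: "m \<le> n \<Longrightarrow> survive n h \<le> survive m h"
proof (induction rule: dec_induct)
  case (step n)
  then show ?case using halt_at_plus_survive[of n h] halt_at_nonneg[of "Suc n" h] by simp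
qed simp

lemma survive_le: "survive m h \<le> (norm (amp h))\<^sup>2"
  using survive_antimono[of 0 m h] by (auto simp: survive_def split: if_splits intro: order_trans)

lemma halt_within_nonneg: "0 \<le> halt_within m h"
  using survive_le[of m h] by (simp add: halt_within_def)

lemma halt_within_mono: "m \<le> n \<Longrightarrow> halt_within m h \<le> halt_within n h"
  using survive_antimono[of m n h] by (simp add: halt_within_def)

lemma halt_within_halted:
  assumes "halted h"
  shows "halt_within m h = (norm (amp h))\<^sup>2"
  using survive_antimono[of 0 m h] survive_nonneg[of m h] assms
  by (auto simp: halt_within_def) (simp add: survive_def)

lemma halt_within_Suc:
  assumes "\<not> halted h"
  shows "halt_within (Suc m) h = (\<Sum>i<K. halt_within m (i # h))"
  by (simp add: halt_within_def survive_Suc sum_subtractf sum_amp_Cons[OF assms]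
      del: amp.simps)

text \<open>Allows a lower bound on the halting mass to be shown by following one chosen outcome per
  step.\<close>

lemma halt_within_Cons:
  assumes "\<not> halted h"
  shows "halt_within m (i # h) \<le> halt_within (Suc m) h"
proof (cases "i < K")
  case True
  then show ?thesis
    by (auto simp: halt_within_Suc[OF assms] halt_within_nonneg intro!: member_le_sum)
next
  case False
  then have "length (ops h) \<le> i" using outcomes[of "state h" "tape w (pos h)" "P w h"] by simp
  then have "amp (i # h) = 0" by simp
  then show ?thesis
    using halt_within_nonneg[of "Suc m" h] survive_nonneg[of m "i # h"]
    unfolding halt_within_def by simp
qed

section \<open>Geometric decay of the surviving mass\<close>

lemma survive_add:
  assumes "\<And>h. survive M h \<le> r * survive 0 h"
  shows "survive (m + M) h \<le> r * survive m h"
proof (induction m arbitrary: h)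
  case 0
  then show ?case using assms by simp
next
  case (Suc m)
  then show ?case by (simp add: survive_Suc sum_distrib_left sum_mono)
qed

lemma survive_0_Nil: "survive 0 [] \<le> 1"
  by (simp add: survive_def)

text \<open>Survival shrinks by the factor \<open>1 - q\<close> every \<open>M\<close> steps. Hence
  its sum S over time satisfies S \<le> M + (1 - q) S, which bounds S.\<close>

lemma
  fixes q :: real and M :: nat
  assumes q: "0 < q"
    and hit: "\<And>h. \<not> halted h \<Longrightarrow> q * (norm (amp h))\<^sup>2 \<le> halt_within M h"
  shows sum_survive_le: "(\<Sum>t<n. survive t []) \<le> real M / q"
    and survive_tendsto_0: "(\<lambda>t. survive t []) \<longlonglongrightarrow> 0"
proof -
  have "survive M h \<le> (1 - q) * survive 0 h" for h
  proof (cases "halted h")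
    case True
    then show ?thesis
      using survive_antimono[of 0 M h] by (simp add: survive_def)
  next
    case False
    then have "survive 0 h = (norm (amp h))\<^sup>2" by (simp add: survive_def)
    then show ?thesis
      using hit[OF False] by (simp add: halt_within_def algebra_simps)
  qed
  then have step: "survive (t + M) [] \<le> (1 - q) * survive t []" for t
    by (rule survive_add)
  show sum_le: "(\<Sum>t<n. survive t []) \<le> real M / q" for n
  proof -
    have "(\<Sum>t<n. survive t []) \<le> (\<Sum>t<n + M. survive t [])"
      by (rule sum_mono2) (auto simp: survive_nonneg)
    also have "\<dots> = (\<Sum>t<M. survive t []) + (\<Sum>t<n. survive (t + M) [])"
      by (induction n) auto
    also have "\<dots> \<le> (\<Sum>t<M. 1) + (\<Sum>t<n. (1 - q) * survive t [])"
      by (intro add_mono sum_mono step order_trans[OF survive_antimono survive_0_Nil]) simp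
    finally have "(\<Sum>t<n. survive t []) \<le> real M + (1 - q) * (\<Sum>t<n. survive t [])"
      by (simp add: sum_distrib_left)
    then have "q * (\<Sum>t<n. survive t []) \<le> M"
      by (simp add: algebra_simps)
    then show ?thesis using q by (simp add: field_simps)
  qed
  have "summable (\<lambda>t. survive t [])"
    by (rule summableI_nonneg_bounded[OF survive_nonneg sum_le])
  then show "(\<lambda>t. survive t []) \<longlonglongrightarrow> 0"
    by (rule summable_LIMSEQ_zero)
qed

section \<open>From finite horizons to sums over all halting histories\<close>

definition histories :: "nat \<Rightarrow> nat list set" where
  "histories n = {h. set h \<subseteq> {..<K} \<and> length h \<le> n \<and> halted h}"

lemma finite_histories: "finite (histories n)"
  by (rule finite_subset[OF _ finite_lists_length_le[of "{..<K}" n]])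
    (auto simp: histories_def)

lemma sum_histories:
  fixes g :: "nat \<Rightarrow> real"
  shows "(\<Sum>h\<in>histories n. g (length h) * history_prob V P w h) = (\<Sum>t\<le>n. g t * halt_at t [])"
proof -
  let ?f = "\<lambda>h. g (length h) * (if halted h then (norm (amp h))\<^sup>2 else 0)"
  have fin: "finite {h. set h \<subseteq> {..<K} \<and> length h = t}" for t
    by (rule finite_lists_length_eq) simp
  have "(\<Sum>h\<in>histories n. g (length h) * history_prob V P w h) = sum ?f (histories n)"
    by (rule sum.cong) (auto simp: amp_normalised(2) histories_def)
  also have "\<dots> = sum ?f {h. set h \<subseteq> {..<K} \<and> length h \<le> n}"
    by (rule sum.mono_neutral_left[OF finite_lists_length_le]) (auto simp: histories_def)
  also have "{h. set h \<subseteq> {..<K} \<and> length h \<le> n} = (\<Union>t\<le>n. {h. set h \<subseteq> {..<K} \<and> length h = t})"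
    by auto
  also have "sum ?f \<dots> = (\<Sum>t\<le>n. sum ?f {h. set h \<subseteq> {..<K} \<and> length h = t})"
    by (rule sum.UNION_disjoint) (use fin in auto)
  also have "\<dots> = (\<Sum>t\<le>n. g t * halt_at t [])"
    by (rule sum.cong[OF refl]) (simp add: halt_at_def over_extensions_Nil sum_distrib_left)
  finally show ?thesis .
qed

lemma sum_halt_at: "(\<Sum>t\<le>n. halt_at t []) = 1 - survive n []"
proof (induction n)
  case (Suc n)
  then show ?case using halt_at_plus_survive[of n "[]"] by simp
qed (simp add: halt_at_def survive_def)

text \<open>Summation by parts: the truncated expected halting time is the sum of the tail
  probabilities minus a nonnegative correction.\<close>

lemma sum_length_halt_at:
  "(\<Sum>t\<le>n. real t * halt_at t []) = (\<Sum>t<n. survive t []) - real n * survive n []"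
proof (induction n)
  case (Suc n)
  have "halt_at (Suc n) [] = survive n [] - survive (Suc n) []"
    using halt_at_plus_survive[of n "[]"] by simp
  then have "real (Suc n) * halt_at (Suc n) [] =
      real (Suc n) * survive n [] - real (Suc n) * survive (Suc n) []"
    by (simp only: right_diff_distrib)
  then show ?case using Suc by (simp add: algebra_simps)
qed simp

lemma set_history: "history_prob V P w h \<noteq> 0 \<Longrightarrow> set h \<subseteq> {..<K}"
proof (induction h)
  case (Cons i h)
  then have "i < length (ops h)"
    by (auto simp: amp_normalised(2) simp del: history_prob.simps split: if_splits)
  then show ?case using Cons outcomes by (auto split: if_splits intro: less_le_trans)
qed simp

lemma history_prob_nonneg: "0 \<le> history_prob V P w h"
  by (simp add: amp_normalised)

text \<open>The infinite sum is the supremum of its finite partial sums, and a finite set of halted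
  histories lies, apart from histories of probability zero, in some
  \<open>histories n\<close>.\<close>

lemma infsum_halted_le:
  fixes g :: "nat \<Rightarrow> real"
  assumes g: "\<And>t. 0 \<le> g t" and le: "\<And>n. (\<Sum>t\<le>n. g t * halt_at t []) \<le> B"
  shows "(\<Sum>\<^sub>\<infinity>h | halted h. ennreal (g (length h) * history_prob V P w h)) \<le> ennreal B"
  unfolding nonneg_infsum_complete[OF zero_le]
proof (rule SUP_least)
  fix F assume "F \<in> {F. finite F \<and> F \<subseteq> {h. halted h}}"
  then have F: "finite F" "F \<subseteq> {h. halted h}" by auto
  let ?f = "\<lambda>h. g (length h) * history_prob V P w h"
  define n where "n = Max (insert 0 (length ` F))"
  have n: "length h \<le> n" if "h \<in> F" for h using that F by (auto simp: n_def)
  have nonneg: "0 \<le> ?f h" for h by (simp add: g history_prob_nonneg)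
  have "sum ?f F = sum ?f (F \<inter> histories n)"
    by (rule sum.mono_neutral_right) (use F n set_history in \<open>force simp: histories_def\<close>)+
  also have "\<dots> \<le> sum ?f (histories n)"
    by (rule sum_mono2) (use finite_histories nonneg in auto)
  finally have "sum ?f F \<le> sum ?f (histories n)" .
  then have "sum ?f F \<le> B" using le[of n] by (simp add: sum_histories)
  then show "(\<Sum>h\<in>F. ennreal (?f h)) \<le> ennreal B"
    by (simp add: sum_ennreal nonneg ennreal_leI)
qed

lemma infsum_halted_eq_1:
  assumes "(\<lambda>t. survive t []) \<longlonglongrightarrow> 0"
  shows "(\<Sum>\<^sub>\<infinity>h | halted h. ennreal (history_prob V P w h)) = 1"
proof (rule antisym)
  show "(\<Sum>\<^sub>\<infinity>h | halted h. ennreal (history_prob V P w h)) \<le> 1"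
    using infsum_halted_le[of "\<lambda>_. 1" 1] by (simp add: sum_halt_at survive_nonneg)
  have "ennreal (1 - survive n []) \<le> (\<Sum>\<^sub>\<infinity>h | halted h. ennreal (history_prob V P w h))" for n
  proof -
    have "ennreal (1 - survive n []) = (\<Sum>h\<in>histories n. ennreal (history_prob V P w h))"
      using sum_histories[of "\<lambda>_. 1" n]
      by (simp add: sum_halt_at sum_ennreal history_prob_nonneg)
    also have "\<dots> = (\<Sum>\<^sub>\<infinity>h\<in>histories n. ennreal (history_prob V P w h))"
      by (simp add: finite_histories)
    also have "\<dots> \<le> (\<Sum>\<^sub>\<infinity>h | halted h. ennreal (history_prob V P w h))"
      by (rule infsum_mono_neutral) (auto simp: histories_def nonneg_summable_on_complete)
    finally show ?thesis .
  qed
  moreover have "(\<lambda>n. ennreal (1 - survive n [])) \<longlonglongrightarrow> ennreal (1 - 0)"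
    by (intro tendsto_ennrealI tendsto_intros assms)
  ultimately show "1 \<le> (\<Sum>\<^sub>\<infinity>h | halted h. ennreal (history_prob V P w h))"
    by (auto intro: LIMSEQ_le_const2)
qed

lemma accept_plus_reject:
  "accept_prob V P w + reject_prob V P w =
    (\<Sum>\<^sub>\<infinity>h | halted h. ennreal (history_prob V P w h))"
proof -
  have "{h. halted h} = {h. state h = acc_state V} \<union> {h. state h = rej_state V}"
    by (auto simp: halting_state_def)
  then show ?thesis
    using qcfa unfolding accept_prob_def reject_prob_def twoway_qcfa_verifier_def
    by (simp, subst infsum_Un_disjoint) (auto simp: nonneg_summable_on_complete)
qed

lemma
  fixes q :: real and M :: nat
  assumes q: "0 < q"
    and hit: "\<And>h. \<not> halted h \<Longrightarrow> q * (norm (amp h))\<^sup>2 \<le> halt_within M h"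
  shows accept_plus_reject_eq_1: "accept_prob V P w + reject_prob V P w = 1"
    and expected_runtime_le: "expected_runtime V P w \<le> ennreal (real M / q)"
proof -
  note q_hit = q hit
  show total: "accept_prob V P w + reject_prob V P w = 1"
    by (simp add: accept_plus_reject infsum_halted_eq_1[OF survive_tendsto_0[OF q_hit]])
  have "of_nat (length h) * ennreal (history_prob V P w h) =
      ennreal (real (length h) * history_prob V P w h)" for h
    by (simp add: ennreal_mult history_prob_nonneg flip: ennreal_of_nat_eq_real_of_nat)
  moreover have "(\<Sum>t\<le>n. real t * halt_at t []) \<le> real M / q" for n
    using sum_survive_le[OF q_hit, of n] by (simp add: sum_length_halt_at)
      (smt (verit) survive_nonneg mult_nonneg_nonneg of_nat_0_le_iff)
  ultimately show "expected_runtime V P w \<le> ennreal (real M / q)"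
    unfolding expected_runtime_def using total by (simp add: infsum_halted_le)
qed

end

text \<open>Serves to compare acceptance with rejection history by history: an injection pairs each
  relevant history of one kind with one of the other kind that is at least \<open>c\<close> times as
  likely.\<close>

lemma infsum_ennreal_le_reindex:
  fixes f :: "'a \<Rightarrow> ennreal" and g :: "'b \<Rightarrow> ennreal" and c :: ennreal
  assumes inj: "inj_on \<phi> A" and sub: "\<phi> ` A \<subseteq> B" and zero: "\<And>x. x \<in> X - A \<Longrightarrow> f x = 0"
    and le: "\<And>x. x \<in> A \<Longrightarrow> c * f x \<le> g (\<phi> x)"
  shows "c * infsum f X \<le> infsum g B"
proof -
  have "infsum f X \<le> infsum f A"
    by (rule infsum_mono_neutral) (auto simp: nonneg_summable_on_complete zero)
  then have "c * infsum f X \<le> c * infsum f A"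
    by (rule mult_left_mono) simp
  also have "\<dots> = infsum (\<lambda>x. c * f x) A"
    by (simp add: nonneg_infsum_complete SUP_mult_left_ennreal sum_distrib_left)
  also have "\<dots> \<le> infsum (g \<circ> \<phi>) A"
    by (rule infsum_mono) (auto simp: nonneg_summable_on_complete le)
  also have "\<dots> = infsum g (\<phi> ` A)"
    by (rule infsum_reindex[OF inj, symmetric])
  also have "\<dots> \<le> infsum g B"
    by (rule infsum_mono_neutral) (use sub in \<open>auto simp: nonneg_summable_on_complete\<close>)
  finally show ?thesis .
qed

section \<open>Completing small operators by restarts\<close>

definition qvec :: "real \<Rightarrow> real \<Rightarrow> real \<Rightarrow> real \<Rightarrow> real^4" where
  "qvec a b c d = vector [a, b, c, d]"

lemma qvec_nth [simp]:
  "qvec a b c d $ 1 = a" "qvec a b c d $ 2 = b" "qvec a b c d $ 3 = c" "qvec a b c d $ 4 = d"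
  by (simp_all add: qvec_def vector_def)

lemma norm_vec4: "(norm (v :: real^4))\<^sup>2 = (v$1)\<^sup>2 + (v$2)\<^sup>2 + (v$3)\<^sup>2 + (v$4)\<^sup>2"
  unfolding power2_norm_eq_inner by (simp add: inner_vec_def sum_4 power2_eq_square)

definition restart_op :: "real^4 \<Rightarrow> real^4^4" where
  "restart_op r = (\<chi> i j. if i = 1 then r $ j else 0)"

lemma restart_op_mult: "restart_op r *v v = axis 1 (r \<bullet> v)"
  by (simp add: vec_eq_iff restart_op_def matrix_vector_mult_def axis_def inner_vec_def)

definition gram :: "(real^4^4) list \<Rightarrow> real^4^4" where
  "gram Es = (\<Sum>E\<leftarrow>Es. transpose E ** E)"

text \<open>The Gram matrices \<open>r r\<^sup>T\<close> of these rows add up to \<open>1 - G\<close> whenever \<open>G\<close> is symmetric with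
  absolute row sums at most 1.\<close>

definition defect_row :: "real^4^4 \<Rightarrow> 4 \<times> 4 \<Rightarrow> real^4" where
  "defect_row G = (\<lambda>(i, j).
     if i = j then sqrt (1 - (\<Sum>k\<in>UNIV. \<bar>G$i$k\<bar>)) *\<^sub>R axis i 1
     else sqrt (\<bar>G$i$j\<bar> / 2) *\<^sub>R (axis i 1 - sgn (G$i$j) *\<^sub>R axis j 1))"

text \<open>All added outcomes leave a multiple of the initial basis vector, so the mass lost by the
  scaled operators starts a fresh round.\<close>

definition restart_completion :: "(real^4^4) list \<Rightarrow> (real^4^4) list" where
  "restart_completion Es = Es @ map (\<lambda>ij. restart_op (defect_row (gram Es) ij))
     (List.product [1, 2, 3, 4] [1, 2, 3, 4])"

lemma length_restart_completion [simp]: "length (restart_completion Es) = length Es + 16"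
  by (simp add: restart_completion_def)

lemma restart_completion_not_Nil [simp]: "restart_completion Es \<noteq> []"
  by (simp flip: length_0_conv)

lemma restart_completion_nth: "i < length Es \<Longrightarrow> restart_completion Es ! i = Es ! i"
  by (simp add: restart_completion_def nth_append)

lemma restart_completion_tail:
  assumes "length Es \<le> i" "i < length Es + 16"
  shows "\<exists>a. restart_completion Es ! i *v v = axis 1 a"
proof -
  have "restart_completion Es ! i = restart_op (defect_row (gram Es)
      (List.product [1, 2, 3, 4] [1, 2, 3, 4] ! (i - length Es)))"
    using assms unfolding restart_completion_def nth_append by (auto simp del: List.product.simps simp: nth_map)
  then show ?thesis by (auto simp: restart_op_mult)
qed

lemma gram_symmetric: "gram Es $ i $ j = gram Es $ j $ i"
  by (induction Es)
    (simp_all add: gram_def matrix_matrix_mult_def transpose_def sum_4 mult.commute)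

lemma gram_diagonal_nonneg: "0 \<le> gram Es $ i $ i"
  by (induction Es)
    (simp_all add: gram_def matrix_matrix_mult_def transpose_def sum_nonneg)

lemma gram_entry_le:
  assumes "\<And>E i j. E \<in> set Es \<Longrightarrow> \<bar>E$i$j\<bar> \<le> 1/8"
  shows "\<bar>gram Es $ i $ j\<bar> \<le> length Es / 16"
  using assms
proof (induction Es)
  case (Cons E Es)
  have e: "\<bar>E$k$i * E$k$j\<bar> \<le> 1/64" for k
    unfolding abs_mult using Cons.prems[of E k i] Cons.prems[of E k j] mult_mono[of "\<bar>E$k$i\<bar>" "1/8" "\<bar>E$k$j\<bar>" "1/8"]
    by simp
  have "\<bar>gram [E] $ i $ j\<bar> \<le> 1/16"
    using e[of 1] e[of 2] e[of 3] e[of 4]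
    by (simp add: gram_def matrix_matrix_mult_def transpose_def sum_4 del: le_divide_eq_numeral1)
  moreover have "gram (E # Es) $ i $ j = gram [E] $ i $ j + gram Es $ i $ j"
    by (simp add: gram_def)
  moreover have "\<bar>gram Es $ i $ j\<bar> \<le> length Es / 16"
    using Cons by simp
  ultimately show ?case by (simp add: field_simps abs_if split: if_splits)
qed (simp add: gram_def)

text \<open>A diagonally dominant symmetric matrix is a sum of rank-one squares. For
  \<open>i \<noteq> j\<close>, the pairs \<open>(i, j)\<close> and \<open>(j, i)\<close> together
  give \<open>- G$i$j\<close> off the diagonal and \<open>\<bar>G$i$j\<bar>\<close> at both diagonal
  places; the rows with \<open>i = j\<close> supply the rest of the diagonal.\<close>

lemma defect_gram:
  fixes G :: "real^4^4"
  assumes sym: "\<And>i j. G$i$j = G$j$i" and diag: "\<And>i. 0 \<le> G$i$i"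
    and row: "\<And>i. (\<Sum>k\<in>UNIV. \<bar>G$i$k\<bar>) \<le> 1"
  shows "(\<Sum>ij\<in>UNIV. defect_row G ij $ k * defect_row G ij $ l) = (mat 1 - G) $ k $ l"
proof -
  have entry: "defect_row G (i, j) $ k * defect_row G (i, j) $ l =
     (if i = j then (1 - (\<Sum>k\<in>UNIV. \<bar>G$i$k\<bar>)) * of_bool (k = i) * of_bool (l = i)
      else \<bar>G$i$j\<bar> / 2 * (of_bool (k = i) - sgn (G$i$j) * of_bool (k = j)) *
        (of_bool (l = i) - sgn (G$i$j) * of_bool (l = j)))" for i j
  proof (cases "i = j")
    case True
    then show ?thesis using row[of i] by (auto simp: defect_row_def axis_def)
  next
    case False
    have comp: "defect_row G (i, j) $ m =
        sqrt (\<bar>G$i$j\<bar> / 2) * (of_bool (m = i) - sgn (G$i$j) * of_bool (m = j))" for m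
      using False by (auto simp: defect_row_def axis_def)
    have "sqrt (\<bar>G$i$j\<bar> / 2) * x * (sqrt (\<bar>G$i$j\<bar> / 2) * y) = \<bar>G$i$j\<bar> / 2 * x * y" for x y
    proof -
      have "sqrt (\<bar>G$i$j\<bar> / 2) * x * (sqrt (\<bar>G$i$j\<bar> / 2) * y) =
          (sqrt (\<bar>G$i$j\<bar> / 2) * sqrt (\<bar>G$i$j\<bar> / 2)) * x * y"
        by (simp only: ac_simps)
      then show ?thesis by (simp add: real_sqrt_mult_self)
    qed
    then show ?thesis using False by (simp only: comp if_False)
  qed
  have "(\<Sum>ij\<in>UNIV. defect_row G ij $ k * defect_row G ij $ l) =
      (\<Sum>i\<in>UNIV. \<Sum>j\<in>UNIV. defect_row G (i, j) $ k * defect_row G (i, j) $ l)"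
    unfolding sum.cartesian_product UNIV_Times_UNIV by (rule sum.cong) auto
  also have "\<dots> =
     (\<Sum>i\<in>UNIV. \<Sum>j\<in>UNIV. (if i = j then (1 - (\<Sum>k\<in>UNIV. \<bar>G$i$k\<bar>)) * of_bool (k = i) * of_bool (l = i)
      else \<bar>G$i$j\<bar> / 2 * (of_bool (k = i) - sgn (G$i$j) * of_bool (k = j)) *
        (of_bool (l = i) - sgn (G$i$j) * of_bool (l = j))))"
    by (simp only: entry)
  also have "\<dots> = (mat 1 - G) $ k $ l"
  proof -
    have g: "G$2$1 = G$1$2" "G$3$1 = G$1$3" "G$4$1 = G$1$4" "G$3$2 = G$2$3" "G$4$2 = G$2$4"
      "G$4$3 = G$3$4"
      by (rule sym)+
    have d: "\<bar>G$i$i\<bar> = G$i$i" for i using diag by simp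
    have abs_sgn: "\<bar>x\<bar> * sgn x * y = x * y" "\<bar>x\<bar> * sgn x * (sgn x * y) = \<bar>x\<bar> * y"
      "\<bar>x\<bar> * sgn x = x" "\<bar>x\<bar> * sgn x * sgn x = \<bar>x\<bar>" "x * sgn x = \<bar>x\<bar>" for x y :: real
      by (auto simp: sgn_if)
    have "\<forall>k l. (\<Sum>i\<in>UNIV. \<Sum>j\<in>UNIV.
        (if i = j then (1 - (\<Sum>k\<in>UNIV. \<bar>G$i$k\<bar>)) * of_bool (k = i) * of_bool (l = i)
         else \<bar>G$i$j\<bar> / 2 * (of_bool (k = i) - sgn (G$i$j) * of_bool (k = j)) *
          (of_bool (l = i) - sgn (G$i$j) * of_bool (l = j)))) = (mat 1 - G) $ k $ l"
      unfolding forall_4 sum_4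
      by (simp add: g d abs_sgn mat_def field_simps)
    then show ?thesis by blast
  qed
  finally show ?thesis .
qed

lemma superoperator_completion:
  assumes "\<And>E i j. E \<in> set Es \<Longrightarrow> \<bar>E$i$j\<bar> \<le> 1/8" and "length Es \<le> 4"
  shows "superoperator (restart_completion Es)"
proof -
  let ?I = "[1, 2, 3, 4] :: 4 list"
  let ?r = "defect_row (gram Es)"
  have "set ?I = UNIV" by (simp only: list.set UNIV_4)
  moreover from this have "distinct ?I" by (intro card_distinct) (simp only:, simp)
  ultimately have I: "distinct ?I" "set ?I = UNIV" by blast+
  \<comment> \<open>Each operator adds at most 4/64 = 1/16 to a Gram entry, so four of them keep the
    entries below 1/4 and the row sums below 1.\<close>
  have row: "(\<Sum>k\<in>UNIV. \<bar>gram Es$i$k\<bar>) \<le> 1" for i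
  proof -
    have "\<bar>gram Es$i$k\<bar> \<le> 1/4" for k
      using gram_entry_le[OF assms(1), of Es i k] assms(2) by simp
    from this[of 1] this[of 2] this[of 3] this[of 4] show ?thesis by (simp add: sum_4)
  qed
  have op: "transpose (restart_op r) ** restart_op r = (\<chi> k l. r$k * r$l)" for r
    by (simp add: vec_eq_iff matrix_matrix_mult_def transpose_def restart_op_def sum_4)
  have "(\<Sum>E\<leftarrow>map (\<lambda>ij. restart_op (?r ij)) (List.product ?I ?I). transpose E ** E) =
      (\<Sum>ij\<leftarrow>List.product ?I ?I. (\<chi> k l. ?r ij $ k * ?r ij $ l))"
    by (simp only: op map_map o_def)
  also have "\<dots> = (\<Sum>ij\<in>UNIV. (\<chi> k l. ?r ij $ k * ?r ij $ l))"
    using I by (subst sum_list_distinct_conv_sum_set) (simp_all only: distinct_product set_product UNIV_Times_UNIV)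
  also have "\<dots> = mat 1 - gram Es"
    unfolding vec_eq_iff sum_component vec_lambda_beta
    by (intro allI defect_gram[OF gram_symmetric gram_diagonal_nonneg row])
  finally have ops: "(\<Sum>E\<leftarrow>map (\<lambda>ij. restart_op (?r ij)) (List.product ?I ?I). transpose E ** E) =
      mat 1 - gram Es" .
  show ?thesis
    unfolding superoperator_def restart_completion_def map_append sum_list_append ops
    by (simp add: gram_def)
qed

text \<open>Each of the four rows has squared norm at most 4/64. This caps the mass that a single
  scaled operator can keep.\<close>

lemma norm_mult_le:
  fixes E :: "real^4^4"
  assumes "\<And>i j. \<bar>E$i$j\<bar> \<le> 1/8"
  shows "(norm (E *v v))\<^sup>2 \<le> (norm v)\<^sup>2 / 4"
proof -
  have row: "((E *v v) $ i)\<^sup>2 \<le> (norm v)\<^sup>2 / 16" for i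
  proof -
    have "((E *v v) $ i)\<^sup>2 = (E $ i \<bullet> v)\<^sup>2"
      by (simp add: matrix_vector_mult_def inner_vec_def)
    also have "\<dots> \<le> (norm (E $ i))\<^sup>2 * (norm v)\<^sup>2"
      using Cauchy_Schwarz_ineq[of "E $ i" v] by (simp add: power2_norm_eq_inner)
    also have "(norm (E $ i))\<^sup>2 \<le> 1/16"
    proof -
      have "(E$i$j)\<^sup>2 \<le> 1/64" for j
        using power_mono[OF assms[of i j], of 2] by (simp add: power2_eq_square)
      from this[of 1] this[of 2] this[of 3] this[of 4] show ?thesis by (simp add: norm_vec4)
    qed
    finally show ?thesis by (simp add: mult_right_mono)
  qed
  show ?thesis
    using row[of 1] row[of 2] row[of 3] row[of 4] by (simp add: norm_vec4[of "E *v v"])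
qed

section \<open>The verifier\<close>

definition word_num :: "bool list \<Rightarrow> nat" where
  "word_num = foldl (\<lambda>m b. 2 * m + of_bool b) 1"

lemma word_num_Nil [simp]: "word_num [] = 1"
  and word_num_snoc [simp]: "word_num (w @ [b]) = 2 * word_num w + of_bool b"
  by (simp_all add: word_num_def)

lemma word_num_pos: "1 \<le> word_num w"
  by (induction w rule: rev_induct) auto

lemma word_num_less: "word_num w < 2 ^ Suc (length w)"
  by (induction w rule: rev_induct) auto

lemma word_num_inject: "word_num v = word_num w \<Longrightarrow> v = w"
proof (induction v arbitrary: w rule: rev_induct)
  case Nil
  then show ?case using word_num_pos[of "butlast w"] by (cases w rule: rev_cases) auto
next
  case (snoc b v)
  show ?case
  proof (cases w rule: rev_cases)
    case Nil
    then show ?thesis using snoc.prems word_num_pos[of v] by simp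
  next
    case (snoc u c)
    with snoc.prems have *: "2 * word_num v + of_bool b = 2 * word_num u + of_bool c" by simp
    then have "b = c" by (cases b; cases c) (auto, presburger+)
    with * snoc.IH[of u] snoc show ?thesis by simp
  qed
qed

text \<open>The left end-marker counts as the leading digit 1, so that the tape itself spells out
  \<open>1w\<close> and can be compared bit by bit.\<close>

fun symbol_digit :: "bool tape_symbol \<Rightarrow> nat" where
  "symbol_digit Left_End = 1"
| "symbol_digit (Input b) = of_bool b"
| "symbol_digit Right_End = 0"

text \<open>The value of the digits at positions before \<open>p\<close>: none at position 0, and
  the end-marker's 1 included from position 1 on.\<close>

definition prefix_num :: "bool list \<Rightarrow> nat \<Rightarrow> nat" where
  "prefix_num w p = (if p = 0 then 0 else word_num (take (p - 1) w))"

lemma prefix_num_0 [simp]: "prefix_num w 0 = 0"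
  by (simp add: prefix_num_def)

lemma prefix_num_end: "prefix_num w (Suc (length w)) = word_num w"
  by (simp add: prefix_num_def)

lemma prefix_num_Suc:
  assumes "p \<le> length w"
  shows "prefix_num w (Suc p) = 2 * prefix_num w p + symbol_digit (tape w p)"
proof (cases p)
  case (Suc k)
  then show ?thesis
    using assms by (simp add: prefix_num_def tape_def take_Suc_conv_app_nth)
qed (simp add: prefix_num_def tape_def)

lemma symbol_digit_le: "symbol_digit x \<le> 1"
  by (cases x) auto

section \<open>Encoding the language by a real in base 4\<close>

definition membership_digit :: "bool list set \<Rightarrow> nat \<Rightarrow> nat" where
  "membership_digit L j = of_bool (j \<in> word_num ` L)"

text \<open>The tail of the encoding from digit \<open>j\<close> on. Base 4 leaves gaps: all tails
  lie in [0, 1/3], so a tail moved by 1 in either direction stays at distance at least 2/3 from that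
  interval.\<close>

definition membership_real :: "bool list set \<Rightarrow> nat \<Rightarrow> real" where
  "membership_real L j = (\<Sum>k. real (membership_digit L (j + k)) * (1/4) ^ Suc k)"

lemma membership_digit_word: "membership_digit L (word_num w) = of_bool (w \<in> L)"
  by (auto simp: membership_digit_def dest: word_num_inject)

lemma quarter_sums: "(\<lambda>k. (1/4 :: real) ^ Suc k) sums (1/3)"
  using sums_mult[OF geometric_sums[of "1/4 :: real"], of "1/4"] by simp

lemma summable_membership: "summable (\<lambda>k. real (membership_digit L (j + k)) * (1/4) ^ Suc k)"
  by (rule summable_comparison_test_ev[OF _ sums_summable[OF quarter_sums]])
    (simp add: membership_digit_def)

lemma membership_real_nonneg: "0 \<le> membership_real L j"
  unfolding membership_real_def by (rule suminf_nonneg[OF summable_membership]) simp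

lemma membership_real_le: "membership_real L j \<le> 1/3"
proof -
  have "membership_real L j \<le> (\<Sum>k. (1/4) ^ Suc k)"
    unfolding membership_real_def
    by (rule suminf_le[OF _ summable_membership sums_summable[OF quarter_sums]])
      (simp add: membership_digit_def)
  then show ?thesis using sums_unique[OF quarter_sums] by simp
qed

lemma membership_real_Suc:
  "4 * membership_real L j = membership_digit L j + membership_real L (Suc j)"
proof -
  have "membership_real L j = (\<Sum>k. real (membership_digit L (j + Suc k)) * (1/4) ^ Suc (Suc k)) +
      membership_digit L j / 4"
    unfolding membership_real_def
    using suminf_split_head[OF summable_membership[of L j]] by simp
  also have "(\<Sum>k. real (membership_digit L (j + Suc k)) * (1/4) ^ Suc (Suc k)) =
      (\<Sum>k. 1/4 * (real (membership_digit L (Suc j + k)) * (1/4) ^ Suc k))"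
    by (simp add: ac_simps)
  also have "\<dots> = 1/4 * membership_real L (Suc j)"
    unfolding membership_real_def by (rule suminf_mult[OF summable_membership])
  finally show ?thesis by simp
qed

text \<open>The register holds the unnormalised vector \<open>(1, \<alpha> - t, x, y)\<close>, where \<open>t\<close> is the real that
  encodes the language, \<open>\<alpha>\<close> its current shift, \<open>x\<close> the number of completed passes over the input,
  and \<open>y\<close> the number formed by the bits received in the current pass. Storing \<open>\<alpha> - t\<close> makes the
  initial vector a basis state. The factor \<open>1/64\<close> makes the operators small enough for
  \<^const>\<open>restart_completion\<close>.\<close>

definition scaled :: "(real^4) list \<Rightarrow> real^4^4" where
  "scaled rs = (1/64) *\<^sub>R vector rs"

definition read_op :: "real \<Rightarrow> real^4^4" where
  "read_op c = scaled [qvec 1 0 0 0, qvec 0 1 0 0, qvec 0 0 1 0, qvec c 0 0 2]"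

text \<open>The entry \<open>3 * t - d\<close> accounts for storing \<open>\<alpha> - t\<close>:
  \<open>4 * (\<alpha> - t) + (3 * t - d) = (4 * \<alpha> - d) - t\<close>.\<close>

definition advance_op :: "real \<Rightarrow> real \<Rightarrow> real^4^4" where
  "advance_op t d = scaled [qvec 1 0 0 0, qvec (3 * t - d) 4 0 0, qvec 1 0 1 0, 0]"

text \<open>Up to scaling its amplitude is the integer \<open>y - (x + 1)\<close>: zero for a
  correct pass number, at least 1 in absolute value for a wrong one.\<close>

definition mismatch_op :: "real^4^4" where
  "mismatch_op = scaled [qvec (-1) 0 (-1) 1, 0, 0, 0]"

definition accept_op :: "real^4^4" where
  "accept_op = scaled [qvec 1 0 0 0, 0, 0, 0]"

text \<open>Competes with the amplitude 1 of \<open>accept_op\<close>. The factor 2 balances the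
  errors: in a correctly numbered pass \<open>1w\<close> with honest earlier digits,
  \<open>4 * \<alpha> - 1\<close> lies in [0, 1/3] for a member and has absolute value at least 2/3
  for a non-member, so the weight is at most 4/9 or at least 16/9. The entry 8 dictates the scale
  1/64.\<close>

definition refute_op :: "real \<Rightarrow> real^4^4" where
  "refute_op t = scaled [qvec (-2) 0 (-2) 2, qvec (8 * t - 2) 8 0 0, 0, 0]"

definition register :: "real \<Rightarrow> real \<Rightarrow> real \<Rightarrow> real \<Rightarrow> real^4" where
  "register a \<beta> x y = a *\<^sub>R qvec 1 \<beta> x y"

lemma scaled_nth:
  "scaled [r, s, u, v] $ 1 = (1/64) *\<^sub>R r" "scaled [r, s, u, v] $ 2 = (1/64) *\<^sub>R s"
  "scaled [r, s, u, v] $ 3 = (1/64) *\<^sub>R u" "scaled [r, s, u, v] $ 4 = (1/64) *\<^sub>R v"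
  by (simp_all add: scaled_def vector_def)

lemma vec4_eq_iff: "(u :: real^4) = v \<longleftrightarrow> u$1 = v$1 \<and> u$2 = v$2 \<and> u$3 = v$3 \<and> u$4 = v$4"
  unfolding vec_eq_iff forall_4 ..

lemma mult_nth: "((E :: real^4^4) *v v) $ i = E$i$1 * v$1 + E$i$2 * v$2 + E$i$3 * v$3 + E$i$4 * v$4"
  by (simp add: matrix_vector_mult_def sum_4)

lemma read_op_register: "read_op c *v register a \<beta> x y = register (a / 64) \<beta> x (2 * y + c)"
  unfolding vec4_eq_iff mult_nth read_op_def scaled_nth register_def
  by (simp add: field_simps)

lemma advance_op_register: "advance_op t d *v register a (\<alpha> - t) x y =
    register (a / 64) (4 * \<alpha> - d - t) (x + 1) 0"
  unfolding vec4_eq_iff mult_nth advance_op_def scaled_nth register_def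
  by (simp add: field_simps)

lemma mismatch_op_register:
  "(norm (mismatch_op *v register a \<beta> x y))\<^sup>2 = (a / 64)\<^sup>2 * (y - x - 1)\<^sup>2"
  unfolding norm_vec4 mult_nth mismatch_op_def scaled_nth register_def
  by (simp add: field_simps power2_eq_square)

lemma accept_op_register: "(norm (accept_op *v register a \<beta> x y))\<^sup>2 = (a / 64)\<^sup>2"
  unfolding norm_vec4 mult_nth accept_op_def scaled_nth register_def
  by (simp add: field_simps power2_eq_square)

lemma refute_op_register: "(norm (refute_op t *v register a (\<alpha> - t) x y))\<^sup>2 =
    (a / 64)\<^sup>2 * (4 * (y - x - 1)\<^sup>2 + 4 * (4 * \<alpha> - 1)\<^sup>2)"
  unfolding norm_vec4 mult_nth refute_op_def scaled_nth register_def
  by (simp add: field_simps power2_eq_square)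

lemma register_0 [simp]: "register 0 \<beta> x y = 0"
  by (simp add: register_def)

lemma norm_restart: "(norm (register a 0 0 0))\<^sup>2 = a\<^sup>2"
  unfolding norm_vec4 register_def by simp

lemma axis_register: "axis 1 a = register a 0 0 0"
  unfolding vec4_eq_iff register_def by (simp add: axis_def)

lemma op_entries:
  assumes "0 \<le> c" "c \<le> 1" "0 \<le> t" "t \<le> 1/3"
  shows "\<bar>read_op c $ i $ j\<bar> \<le> 1/8" "\<bar>advance_op t c $ i $ j\<bar> \<le> 1/8"
    "\<bar>mismatch_op $ i $ j\<bar> \<le> 1/8" "\<bar>accept_op $ i $ j\<bar> \<le> 1/8" "\<bar>refute_op t $ i $ j\<bar> \<le> 1/8"
proof -
  have "\<forall>i j. \<bar>read_op c $ i $ j\<bar> \<le> 1/8"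
    unfolding forall_4 read_op_def scaled_nth using assms by simp
  then show "\<bar>read_op c $ i $ j\<bar> \<le> 1/8" by blast
  have "\<forall>i j. \<bar>advance_op t c $ i $ j\<bar> \<le> 1/8"
    unfolding forall_4 advance_op_def scaled_nth using assms by (simp add: abs_if)
  then show "\<bar>advance_op t c $ i $ j\<bar> \<le> 1/8" by blast
  have "\<forall>i j. \<bar>mismatch_op $ i $ j\<bar> \<le> 1/8"
    unfolding forall_4 mismatch_op_def scaled_nth by simp
  then show "\<bar>mismatch_op $ i $ j\<bar> \<le> 1/8" by blast
  have "\<forall>i j. \<bar>accept_op $ i $ j\<bar> \<le> 1/8"
    unfolding forall_4 accept_op_def scaled_nth by simp
  then show "\<bar>accept_op $ i $ j\<bar> \<le> 1/8" by blast
  have "\<forall>i j. \<bar>refute_op t $ i $ j\<bar> \<le> 1/8"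
    unfolding forall_4 refute_op_def scaled_nth using assms by (simp add: abs_if)
  then show "\<bar>refute_op t $ i $ j\<bar> \<le> 1/8" by blast
qed

text \<open>State 0 moves the head to the left end and starts a pass; states 1 and 2 read the bits of a
  pass and record whether they agree so far with those of \<open>1w\<close>; states 3 and 4 accept and reject.\<close>

definition word_ops :: "real \<Rightarrow> nat \<Rightarrow> bool tape_symbol \<Rightarrow> nat \<Rightarrow> (real^4^4) list" where
  "word_ops t s x c =
     (if s = 0 \<and> x \<noteq> Left_End then [mat 1]
      else if x \<noteq> Right_End then restart_completion [read_op (real c)]
      else if s = 1 then restart_completion [accept_op, refute_op t]
      else restart_completion [advance_op t (real c), mismatch_op])"

definition word_step :: "nat \<Rightarrow> bool tape_symbol \<Rightarrow> nat \<Rightarrow> nat \<Rightarrow> nat \<times> head_move" where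
  "word_step s x c i =
     (if s = 0 \<and> x \<noteq> Left_End then (0, Move_Left)
      else if x \<noteq> Right_End then
        (if i = 0 then (if s \<noteq> 2 \<and> c = symbol_digit x then 1 else 2, Move_Right) else (0, Stay))
      else if s = 1 then (if i = 0 then 3 else if i = 1 then 4 else 0, Stay)
      else (if i = 1 then 4 else 0, Stay))"

definition word_verifier :: "real \<Rightarrow> (nat, nat, bool, 4) verifier" where
  "word_verifier t = \<lparr>states = {..4}, init_state = 0, acc_state = 3, rej_state = 4,
     comm_alphabet = {0, 1}, init_basis = 1, superop = word_ops t, transition = word_step\<rparr>"

lemma word_verifier_simps [simp]:
  "states (word_verifier t) = {..4}" "init_state (word_verifier t) = 0"
  "acc_state (word_verifier t) = 3" "rej_state (word_verifier t) = 4"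
  "comm_alphabet (word_verifier t) = {0, 1}" "init_basis (word_verifier t) = 1"
  "superop (word_verifier t) = word_ops t" "transition (word_verifier t) = word_step"
  by (simp_all add: word_verifier_def)

lemma halting_word_verifier [simp]: "halting_state (word_verifier t) s \<longleftrightarrow> s = 3 \<or> s = 4"
  by (simp add: halting_state_def)

lemma superoperator_word_ops:
  assumes "0 \<le> t" "t \<le> 1/3" "c \<le> 1"
  shows "superoperator (word_ops t s x c)"
proof -
  have "superoperator [mat 1 :: real^4^4]"
    by (simp add: superoperator_def)
  then show ?thesis
    unfolding word_ops_def using assms op_entries[of "real c" t]
    by (auto intro!: superoperator_completion)
qed

lemma word_step_valid:
  assumes "word_step s x c i = (s', d)"
  shows "s' \<le> 4" "x = Left_End \<Longrightarrow> d \<noteq> Move_Left" "x = Right_End \<Longrightarrow> d \<noteq> Move_Right"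
  using assms unfolding word_step_def by (auto split: if_splits)

lemma twoway_qcfa_word_verifier:
  assumes "0 \<le> t" "t \<le> 1/3"
  shows "twoway_qcfa_verifier (word_verifier t)"
proof -
  have "superoperator (word_ops t s x c)" if "c \<in> {0, 1}" for s x c
    using superoperator_word_ops[OF assms, of c] that by auto
  moreover have "s' \<in> {..4}" "x = Left_End \<longrightarrow> d \<noteq> Move_Left" "x = Right_End \<longrightarrow> d \<noteq> Move_Right"
    if "word_step s x c i = (s', d)" for s x c i s' d
    using word_step_valid[OF that] by simp_all
  ultimately show ?thesis
    unfolding twoway_qcfa_verifier_def word_verifier_simps
    by (intro conjI ballI impI allI) simp_all
qed

lemma length_word_ops: "length (word_ops t s x c) \<le> 18"
  by (simp add: word_ops_def)

section \<open>Soundness\<close>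

locale word_run =
  fixes L :: "bool list set" and P :: "(bool, nat) prover" and w :: "bool list"
    and t :: real
  assumes prover: "prover_for (word_verifier t) P"
    and t_eq: "t = membership_real L 1"
begin

sublocale verifier_run "word_verifier t" P w 18
proof
  show "twoway_qcfa_verifier (word_verifier t)"
    unfolding t_eq by (rule twoway_qcfa_word_verifier[OF membership_real_nonneg membership_real_le])
qed (use prover length_word_ops in simp_all)

declare config_after.simps(2) [simp del] amp.simps(2) [simp del] history_prob.simps(2) [simp del]

lemma message_le: "P w h \<le> 1"
  using prover unfolding prover_for_def by (metis empty_iff insert_iff le_numeral_extra(4) word_verifier_simps(5) zero_le)

lemma tape_eq_Left_End [simp]: "tape w p = Left_End \<longleftrightarrow> p = 0"
  and tape_eq_Right_End [simp]: "tape w p = Right_End \<longleftrightarrow> length w < p"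
  by (auto simp: tape_def)

section \<open>Phases of a run, one step at a time\<close>

lemmas step_simps = state_Cons pos_Cons word_step_def

lemma control_bounds: "pos h \<le> Suc (length w) \<and> state h \<le> 4 \<and> (state h \<in> {1, 2} \<longrightarrow> 1 \<le> pos h)"
proof (induction h)
  case Nil
  then show ?case by (simp add: state_Nil pos_Nil del: config_after.simps)
next
  case (Cons i h)
  then show ?case by (auto simp: step_simps)
qed

text \<open>The running histories whose next step applies a scaled operator; the others rewind the
  head and leave the register alone.\<close>

definition lossy :: "nat list \<Rightarrow> bool" where
  "lossy h \<longleftrightarrow> state h < 3 \<and> (state h = 0 \<longrightarrow> pos h = 0)"

lemma rewind_step:
  assumes "state h = 0" "pos h \<noteq> 0"
  shows "state (0 # h) = 0" "pos (0 # h) = pos h - 1" "amp (0 # h) = amp h"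
  using assms by (auto simp: step_simps amp.simps word_ops_def)

lemma amp_lossy:
  assumes "lossy h"
  shows "amp (i # h) = (if i < length (word_ops t (state h) (tape w (pos h)) (P w h))
    then word_ops t (state h) (tape w (pos h)) (P w h) ! i *v amp h else 0)"
  using assms by (simp add: amp.simps lossy_def)

text \<open>The excluded outcomes are those of the genuine operators, one while reading and two at
  the right end; the remaining ones belong to the completion.\<close>

lemma restart_step:
  assumes "lossy h" "i \<noteq> 0" "length w < pos h \<Longrightarrow> i \<noteq> 1"
  shows "state (i # h) = 0" "pos (i # h) = pos h" "\<exists>a. amp (i # h) = register a 0 0 0"
proof -
  show "state (i # h) = 0" "pos (i # h) = pos h"
    using assms by (auto simp: step_simps lossy_def)
  define Es where "Es = (if tape w (pos h) \<noteq> Right_End then [read_op (real (P w h))]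
    else if state h = 1 then [accept_op, refute_op t] else [advance_op t (real (P w h)), mismatch_op])"
  have Es: "word_ops t (state h) (tape w (pos h)) (P w h) = restart_completion Es" "length Es \<le> i"
    using assms by (auto simp: word_ops_def lossy_def Es_def)
  show "\<exists>a. amp (i # h) = register a 0 0 0"
  proof (cases "i < length Es + 16")
    case True
    then obtain a where "restart_completion Es ! i *v amp h = axis 1 a"
      using restart_completion_tail[OF Es(2)] by blast
    then show ?thesis using True by (auto simp: amp_lossy[OF assms(1)] Es(1) axis_register)
  next
    case False
    then show ?thesis by (auto simp: amp_lossy[OF assms(1)] Es(1) intro: exI[of _ 0])
  qed
qed

text \<open>Links the classical flag to the number in the register, so that at the right end the
  flag tells whether that number is \<open>word_num w\<close>.\<close>

definition in_step :: "nat list \<Rightarrow> nat \<Rightarrow> bool" where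
  "in_step h y \<longleftrightarrow> (state h = 0 \<longrightarrow> y = 0) \<and> (state h = 1 \<longrightarrow> y = prefix_num w (pos h)) \<and>
     (state h = 2 \<longrightarrow> y \<noteq> prefix_num w (pos h))"

lemma read_step:
  assumes "lossy h" "pos h \<le> length w"
  shows "state (0 # h) \<in> {1, 2}" "pos (0 # h) = Suc (pos h)"
    "in_step h y \<Longrightarrow> in_step (0 # h) (2 * y + P w h)"
    "amp h = register a \<beta> x y' \<Longrightarrow> amp (0 # h) = register (a / 64) \<beta> x (2 * y' + real (P w h))"
proof -
  have st': "state (0 # h) =
      (if state h \<noteq> 2 \<and> P w h = symbol_digit (tape w (pos h)) then 1 else 2)"
    and p: "pos (0 # h) = Suc (pos h)"
    using assms by (auto simp: step_simps lossy_def)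
  then show "state (0 # h) \<in> {1, 2}" "pos (0 # h) = Suc (pos h)" by simp_all
  show "amp (0 # h) = register (a / 64) \<beta> x (2 * y' + real (P w h))" if "amp h = register a \<beta> x y'"
    using assms that by (auto simp: amp_lossy word_ops_def restart_completion_nth read_op_register lossy_def)
  assume y: "in_step h y"
  define b where "b = symbol_digit (tape w (pos h))"
  \<comment> \<open>Appending a bit is injective in the number and the bit, so later bits never
    repair a disagreement.\<close>
  have "2 * y + P w h = 2 * prefix_num w (pos h) + b \<longleftrightarrow> y = prefix_num w (pos h) \<and> P w h = b"
    using message_le[of h] symbol_digit_le[of "tape w (pos h)"] unfolding b_def[symmetric]
    by presburger
  then have eq: "2 * y + P w h = prefix_num w (Suc (pos h)) \<longleftrightarrow>
      y = prefix_num w (pos h) \<and> P w h = b"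
    by (simp only: prefix_num_Suc[OF assms(2)] b_def)
  have "state h \<noteq> 2 \<longleftrightarrow> y = prefix_num w (pos h)"
    using y assms(1) unfolding in_step_def lossy_def by (cases "state h = 0") (auto simp: less_Suc_eq numeral_3_eq_3)
  then show "in_step (0 # h) (2 * y + P w h)"
    unfolding in_step_def p eq st' b_def[symmetric] by simp
qed

lemma advance_step:
  assumes "state h = 2" "length w < pos h" "amp h = register a (\<alpha> - t) x y"
  shows "state (0 # h) = 0" "pos (0 # h) = pos h"
    "amp (0 # h) = register (a / 64) (4 * \<alpha> - P w h - t) (x + 1) 0"
    "state (1 # h) = 4" "(norm (amp (1 # h)))\<^sup>2 = (a / 64)\<^sup>2 * (y - x - 1)\<^sup>2"
proof -
  have "lossy h" using assms by (simp add: lossy_def)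
  show "state (0 # h) = 0" "pos (0 # h) = pos h" "state (1 # h) = 4"
    using assms by (auto simp: step_simps)
  show "amp (0 # h) = register (a / 64) (4 * \<alpha> - P w h - t) (x + 1) 0"
    "(norm (amp (1 # h)))\<^sup>2 = (a / 64)\<^sup>2 * (y - x - 1)\<^sup>2"
    using assms by (simp_all add: amp_lossy[OF \<open>lossy h\<close>] word_ops_def restart_completion_nth
        advance_op_register mismatch_op_register)
qed

lemma decide_step:
  assumes "state h = 1" "length w < pos h" "amp h = register a (\<alpha> - t) x y"
  shows "state (0 # h) = 3" "(norm (amp (0 # h)))\<^sup>2 = (a / 64)\<^sup>2"
    "state (1 # h) = 4"
    "(norm (amp (1 # h)))\<^sup>2 = (a / 64)\<^sup>2 * (4 * (y - x - 1)\<^sup>2 + 4 * (4 * \<alpha> - 1)\<^sup>2)"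
proof -
  have "lossy h" using assms by (simp add: lossy_def)
  show "state (0 # h) = 3" "state (1 # h) = 4"
    using assms by (auto simp: step_simps)
  show "(norm (amp (0 # h)))\<^sup>2 = (a / 64)\<^sup>2"
    "(norm (amp (1 # h)))\<^sup>2 = (a / 64)\<^sup>2 * (4 * (y - x - 1)\<^sup>2 + 4 * (4 * \<alpha> - 1)\<^sup>2)"
    using assms by (simp_all add: amp_lossy[OF \<open>lossy h\<close>] word_ops_def restart_completion_nth
        accept_op_register refute_op_register)
qed

lemma in_step_end:
  assumes "in_step h y" "pos h = Suc (length w)"
  shows "state h = 1 \<Longrightarrow> y = word_num w" "state h = 2 \<Longrightarrow> y \<noteq> word_num w"
  using assms by (simp_all add: in_step_def prefix_num_end)

lemma history_cases:
  assumes "state h < 3"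
  obtains "state h = 0" "pos h \<noteq> 0" | "lossy h" "pos h \<le> length w"
    | "state h = 1" "pos h = Suc (length w)" | "state h = 2" "pos h = Suc (length w)"
proof -
  have "pos h \<le> length w \<or> pos h = Suc (length w)" "state h = 0 \<or> state h = 1 \<or> state h = 2"
    using control_bounds[of h] assms by auto
  then show thesis using that by (cases "pos h = 0") (auto simp: lossy_def)
qed

text \<open>Once the prover has sent a wrong digit, \<open>\<alpha>\<close> stays at distance at least \<open>2/3\<close> from 0.\<close>

definition coherent :: "nat list \<Rightarrow> bool" where
  "coherent h \<longleftrightarrow> state h < 3 \<longrightarrow> (\<exists>a \<alpha> x y.
     amp h = register a (\<alpha> - t) (real x) (real y) \<and> in_step h y \<and>
     (\<alpha> = membership_real L (Suc x) \<or> 2/3 \<le> \<bar>\<alpha>\<bar>))"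

lemma coherentI:
  assumes "amp h = register a (\<alpha> - t) (real x) (real y)" "in_step h y"
    "\<alpha> = membership_real L (Suc x) \<or> 2/3 \<le> \<bar>\<alpha>\<bar>"
  shows "coherent h"
  using assms unfolding coherent_def by blast

lemma coherent_zero:
  assumes "amp h = 0"
  shows "coherent h"
proof (rule coherentI)
  \<comment> \<open>The factor 0 annihilates the vector, so the counter may be chosen to suit
    \<open>in_step\<close>.\<close>
  show "amp h = register 0 (membership_real L (Suc 0) - t) (real 0)
      (real (if state h = 0 then 0 else if state h = 1 then prefix_num w (pos h)
        else Suc (prefix_num w (pos h))))"
    using assms by simp
qed (simp_all add: in_step_def)

lemma coherent_restart:
  assumes "amp h = register a 0 0 0" "state h = 0"
  shows "coherent h"
proof (rule coherentI)
  show "amp h = register a (membership_real L (Suc 0) - t) (real 0) (real 0)"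
    using assms t_eq by simp
qed (simp_all add: assms in_step_def)

text \<open>If \<open>\<alpha>\<close> is a tail, \<open>4 * \<alpha> - d\<close> is the next tail
  plus the digit error 0, 1 or -1. If \<open>\<alpha>\<close> is already 2/3 away from 0, the new
  value is at least 8/3 - 1 away.\<close>

lemma shift_dichotomy:
  fixes d :: nat
  assumes "\<alpha> = membership_real L j \<or> 2/3 \<le> \<bar>\<alpha>\<bar>" "d \<le> 1"
  shows "4 * \<alpha> - d = membership_real L (Suc j) \<or> 2/3 \<le> \<bar>4 * \<alpha> - d\<bar>"
    and "d \<noteq> membership_digit L j \<Longrightarrow> 2/3 \<le> \<bar>4 * \<alpha> - d\<bar>"
proof -
  have d: "real d = 0 \<or> real d = 1" and e: "real (membership_digit L j) = 0 \<or> real (membership_digit L j) = 1"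
    using assms(2) by (auto simp: membership_digit_def)
  note b = membership_real_Suc[of L j] membership_real_nonneg[of L "Suc j"]
    membership_real_le[of L "Suc j"]
  have wrong: "2/3 \<le> \<bar>4 * \<alpha> - d\<bar>" if "real d \<noteq> real (membership_digit L j) \<or> 2/3 \<le> \<bar>\<alpha>\<bar>"
    using that assms(1) d e b by (elim disjE; linarith)
  show "4 * \<alpha> - d = membership_real L (Suc j) \<or> 2/3 \<le> \<bar>4 * \<alpha> - d\<bar>"
    using wrong assms(1) b(1) by (cases "real d = real (membership_digit L j)") auto
  show "2/3 \<le> \<bar>4 * \<alpha> - d\<bar>" if "d \<noteq> membership_digit L j"
    using wrong that by simp
qed

text \<open>Holds against every prover: a restart brings back \<open>x = 0\<close> and the tail from
  1, and otherwise only an advance changes \<open>\<alpha>\<close>, where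
  \<open>shift_dichotomy\<close> applies.\<close>

lemma coherent: "coherent h"
proof (induction h)
  case Nil
  show ?case
    by (rule coherent_restart[of _ 1]) (simp_all add: axis_register state_Nil del: config_after.simps)
next
  case (Cons i h)
  show ?case
  proof (cases "amp (i # h) = 0 \<or> 3 \<le> state (i # h)")
    case True
    then show ?thesis using coherent_zero by (auto simp: coherent_def)
  next
    case False
    then have "\<not> halted h" by (auto simp: amp.simps)
    then have "state h < 3" using control_bounds[of h] by auto
    then obtain a \<alpha> x y where amp: "amp h = register a (\<alpha> - t) (real x) (real y)"
      and y: "in_step h y" and \<alpha>: "\<alpha> = membership_real L (Suc x) \<or> 2/3 \<le> \<bar>\<alpha>\<bar>"
      using Cons unfolding coherent_def by blast
    show ?thesis
      using \<open>state h < 3\<close>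
    proof (cases rule: history_cases)
      case 1
      with False have "i = 0" by (auto simp: amp.simps word_ops_def split: if_splits)
      then show ?thesis using amp y \<alpha> rewind_step[OF 1] 1
        by (intro coherentI[of _ a \<alpha> x y]) (auto simp: in_step_def)
    next
      case 2
      show ?thesis
      proof (cases "i = 0")
        case True
        then show ?thesis using read_step[OF 2] amp y \<alpha>
          by (intro coherentI[of _ "a / 64" \<alpha> x "2 * y + P w h"]) simp_all
      next
        case False
        then show ?thesis using restart_step[of h i] 2 coherent_restart by auto
      qed
    next
      case 3
      then have "i \<noteq> 0" "i \<noteq> 1" using False by (auto simp: step_simps split: if_splits)
      then show ?thesis using restart_step[of h i] 3 coherent_restart by (auto simp: lossy_def)
    next
      case 4
      show ?thesis
      proof (cases "i = 0")
        case True
        have adv: "state (0 # h) = 0"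
          "amp (0 # h) = register (a / 64) (4 * \<alpha> - P w h - t) (real (Suc x)) (real 0)"
          using advance_step(1,3)[OF 4(1) _ amp] 4(2) by (simp_all add: add.commute)
        show ?thesis
          unfolding True using shift_dichotomy(1)[OF \<alpha> message_le]
          by (intro coherentI[OF adv(2)]) (simp_all add: adv in_step_def)
      next
        case i: False
        then have "i \<noteq> 1" using 4 False by (auto simp: step_simps)
        then show ?thesis using restart_step[of h i] i 4 coherent_restart by (auto simp: lossy_def)
      qed
    qed
  qed
qed

section \<open>Odds of rejection against every prover\<close>

text \<open>State 1 at the right end means \<open>y = word_num w\<close>. If this is the pass
  number, digit 1 is wrong and the weight is at least 4 * (2/3)^2 = 16/9; otherwise the number alone
  contributes at least 4.\<close>

lemma refute_non_member:
  assumes "w \<notin> L" "state h = 1" "pos h = Suc (length w)"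
  shows "16/9 * history_prob (word_verifier t) P w (0 # h) \<le>
    history_prob (word_verifier t) P w (1 # h)"
proof -
  obtain a \<alpha> x y where amp: "amp h = register a (\<alpha> - t) (real x) (real y)"
    and y: "in_step h y" and \<alpha>: "\<alpha> = membership_real L (Suc x) \<or> 2/3 \<le> \<bar>\<alpha>\<bar>"
    using coherent[of h] assms unfolding coherent_def by auto
  have "y = word_num w" using in_step_end[OF y assms(3)] assms(2) by simp
  have "16/9 \<le> 4 * (real y - real x - 1)\<^sup>2 + 4 * (4 * \<alpha> - 1)\<^sup>2"
  proof (cases "y = Suc x")
    case True
    then have "1 \<noteq> membership_digit L (Suc x)"
      using assms(1) \<open>y = word_num w\<close> membership_digit_word[of L w] by simp
    then have "2/3 \<le> \<bar>4 * \<alpha> - 1\<bar>"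
      using shift_dichotomy(2)[OF \<alpha>, of 1] by simp
    then have "(2/3)\<^sup>2 \<le> (4 * \<alpha> - 1)\<^sup>2"
      using power_mono[of "2/3" "\<bar>4 * \<alpha> - 1\<bar>" 2] by simp
    then show ?thesis using True by (simp add: power2_eq_square)
  next
    case False
    then have "1 \<le> \<bar>real y - real x - 1\<bar>" by linarith
    then have "1 \<le> (real y - real x - 1)\<^sup>2"
      using power_mono[of 1 "\<bar>real y - real x - 1\<bar>" 2] by simp
    then show ?thesis using zero_le_power2[of "4 * \<alpha> - 1"] by linarith
  qed
  then have "(a / 64)\<^sup>2 * (16/9) \<le> (a / 64)\<^sup>2 * (4 * (real y - real x - 1)\<^sup>2 + 4 * (4 * \<alpha> - 1)\<^sup>2)"
    by (rule mult_left_mono) simp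
  then show ?thesis
    using decide_step(2,4)[OF assms(2) _ amp] assms(3)
    by (simp only: amp_normalised(2) mult.commute[of "16/9"] lessI)
qed

lemma accepting_history:
  assumes "state (i # h) = 3"
  shows "i = 0 \<and> state h = 1 \<and> pos h = Suc (length w)"
  using assms control_bounds[of h] by (auto simp: step_simps split: if_splits)

lemma rejecting_history:
  assumes "state (i # h) = 4"
  shows "i = 1 \<and> pos h = Suc (length w)"
  using assms control_bounds[of h] by (auto simp: step_simps split: if_splits)

text \<open>An accepting history ends with outcome 0; outcome 1 in its place rejects, after the same
  past.\<close>

lemma reject_non_member:
  assumes "w \<notin> L"
  shows "ennreal (16/9) * accept_prob (word_verifier t) P w \<le> reject_prob (word_verifier t) P w"
  unfolding accept_prob_def reject_prob_def
proof (rule infsum_ennreal_le_reindex[where A = "{h. state h = 3}" and \<phi> = "\<lambda>h. 1 # tl h"])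
  have decision: "\<exists>h'. h = 0 # h' \<and> state h' = 1 \<and> pos h' = Suc (length w)" if "state h = 3" for h
    using that accepting_history by (cases h) (auto simp: state_Nil simp del: config_after.simps)
  show "inj_on (\<lambda>h. 1 # tl h) {h. state h = 3}"
    by (auto simp: inj_on_def dest!: decision)
  show "(\<lambda>h. 1 # tl h) ` {h. state h = 3} \<subseteq> {h. state h = rej_state (word_verifier t)}"
    by (auto simp: step_simps dest!: decision)
  show "ennreal (16/9) * ennreal (history_prob (word_verifier t) P w h) \<le>
      ennreal (history_prob (word_verifier t) P w (1 # tl h))" if h: "h \<in> {h. state h = 3}" for h
  proof -
    obtain h' where "h = 0 # h'" "state h' = 1" "pos h' = Suc (length w)" using decision h by blast
    then show ?thesis
      using refute_non_member[OF assms, of h'] by (simp add: history_prob_nonneg ennreal_leI flip: ennreal_mult)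
  qed
qed simp

end

section \<open>Expected runtime\<close>

text \<open>Since N * (n + 2) \<le> 4 * 4^n, the inverse square contributes at most 2^(48 * 4^n).
  The remaining factors contribute at most 2^(8 * 4^n + 1), and 64 * 4^n = 2^(2n + 6) exceeds the
  sum of the exponents.\<close>

lemma double_exponential_bound:
  assumes N: "N < (2::nat) ^ Suc n"
  shows "real (Suc N * (2 * n + 3)) / (3/4 * (1 / 64 ^ (N * (n + 2)))\<^sup>2) \<le>
    2 powr (2 powr (2 * real n + 6))"
proof -
  define k where "k = N * (n + 2)"
  have le: "n + 2 \<le> 2 ^ Suc n" by (induction n) auto
  have four: "(2::nat) ^ Suc n * 2 ^ Suc n = 4 * 4 ^ n"
    using power_mult_distrib[of "2::nat" 2 n] by simp
  have "k \<le> 2 ^ Suc n * 2 ^ Suc n"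
    unfolding k_def using N le by (intro mult_mono) simp_all
  then have exp: "12 * k \<le> 48 * 4 ^ n" unfolding four by simp
  have "2 * n + 3 \<le> 2 * 2 ^ Suc n" using le by linarith
  then have "Suc N * (2 * n + 3) \<le> 2 ^ Suc n * (2 * 2 ^ Suc n)"
    using N by (intro mult_mono) simp_all
  also have "\<dots> = 8 * 4 ^ n" using four by simp
  also have "\<dots> \<le> 2 ^ (8 * 4 ^ n)" by (rule less_imp_le[OF less_exp])
  finally have poly: "Suc N * (2 * n + 3) \<le> 2 ^ (8 * 4 ^ n)" .
  have "(64::real) ^ k * 64 ^ k = 2 ^ (12 * k)"
    using power_mult[of "2::real" 6 k] power_add[of "2::real" "6 * k" "6 * k"] by simp
  then have "real (Suc N * (2 * n + 3)) / (3/4 * (1 / 64 ^ k)\<^sup>2) =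
      4/3 * real (Suc N * (2 * n + 3)) * 2 ^ (12 * k)"
    by (simp only: power2_eq_square) (simp add: field_simps del: of_nat_mult of_nat_Suc mult_Suc)
  also have "\<dots> \<le> 2 ^ (8 * 4 ^ n + 1) * 2 ^ (48 * 4 ^ n)"
  proof (rule mult_mono)
    have "real (Suc N * (2 * n + 3)) \<le> 2 ^ (8 * 4 ^ n)"
      using poly by (metis of_nat_le_iff of_nat_numeral of_nat_power)
    then show "4/3 * real (Suc N * (2 * n + 3)) \<le> 2 ^ (8 * 4 ^ n + 1)"
      unfolding power_add power_one_right using of_nat_0_le_iff[of "Suc N * (2 * n + 3)", where 'a = real]
      by linarith
    show "(2::real) ^ (12 * k) \<le> 2 ^ (48 * 4 ^ n)"
      using exp by (rule power_increasing) simp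
  qed simp_all
  also have "\<dots> \<le> 2 ^ (64 * 4 ^ n)"
    unfolding power_add[symmetric] by (rule power_increasing) simp_all
  also have "\<dots> = 2 powr (2 powr (2 * real n + 6))"
  proof -
    have "real (64 * 4 ^ n) = 2 powr (2 * real n + 6)"
      by (simp add: powr_add powr_powr[symmetric] powr_realpow)
    then show ?thesis
      using powr_realpow[of "2::real" "64 * 4 ^ n"] by (simp only: zero_less_numeral)
  qed
  finally show ?thesis by (simp only: k_def)
qed

context word_run
begin

section \<open>Halting within boundedly many steps\<close>

lemma rewind_halt_within:
  assumes "state h = 0"
    and "\<And>h'. state h' = 0 \<Longrightarrow> pos h' = 0 \<Longrightarrow> amp h' = amp h \<Longrightarrow> B \<le> halt_within m h'"
  shows "B \<le> halt_within (m + pos h) h"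
  using assms
proof (induction "pos h" arbitrary: h)
  case 0
  then show ?case by simp
next
  case (Suc k)
  have r: "state (0 # h) = 0" "pos (0 # h) = k" "amp (0 # h) = amp h"
    using rewind_step[of h] Suc.hyps(2) Suc.prems(1) by simp_all
  have "B \<le> halt_within (m + k) (0 # h)"
    using Suc.hyps(1)[of "0 # h"] r Suc.prems(2) by simp
  also have "\<dots> \<le> halt_within (Suc (m + k)) h"
    using Suc.prems(1) by (intro halt_within_Cons) simp
  finally show ?case by (simp flip: Suc.hyps(2))
qed

text \<open>Follows outcome 0 up to the right end; each symbol costs a factor 1/64 in amplitude,
  whatever bits the prover sends.\<close>

lemma read_halt_within:
  assumes "lossy h" "amp h = register a \<beta> x (real y)" "in_step h y"
    and "r = Suc (length w) - pos h"
    and "\<And>h' y'. pos h' = Suc (length w) \<Longrightarrow> state h' = 1 \<or> state h' = 2 \<Longrightarrow>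
      amp h' = register (a / 64 ^ r) \<beta> x (real y') \<Longrightarrow> in_step h' y' \<Longrightarrow> B \<le> halt_within m h'"
  shows "B \<le> halt_within (m + r) h"
  using assms
proof (induction r arbitrary: h a y)
  case 0
  then have "pos h = Suc (length w)" using control_bounds[of h] by simp
  moreover from this have "state h = 1 \<or> state h = 2"
    using 0(1) by (auto simp: lossy_def less_Suc_eq numeral_3_eq_3)
  ultimately show ?case using 0(2,3) 0(5)[of h y] by simp
next
  case (Suc r)
  then have p: "pos h \<le> length w" by simp
  note s = read_step[OF Suc.prems(1) p]
  have amp: "amp (0 # h) = register (a / 64) \<beta> x (real (2 * y + P w h))"
    using s(4)[OF Suc.prems(2)] by simp
  have "B \<le> halt_within (m + r) (0 # h)"
  proof (rule Suc.IH[OF _ amp s(3)[OF Suc.prems(3)]])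
    show "lossy (0 # h)" using s(1) by (auto simp: lossy_def)
    show "r = Suc (length w) - pos (0 # h)" using Suc.prems(4) s(2) by simp
  qed (use Suc.prems(5) in simp)
  also have "\<dots> \<le> halt_within (Suc (m + r)) h"
    using Suc.prems(1) by (intro halt_within_Cons) (simp add: lossy_def)
  finally show ?case by simp
qed

text \<open>Every prover must let the verifier halt within the next passes: as long as the numbers it
  sends are correct they increase towards \<open>word_num w\<close>, which forces a decision.\<close>

lemma passes_halt_within:
  assumes "state h = 0" "pos h = 0" "amp h = register a (\<alpha> - t) (real x) 0"
    and "word_num w = x + k" "0 < k"
  shows "(a / 64 ^ (k * (length w + 2)))\<^sup>2 \<le> halt_within (k * (2 * length w + 3)) h"
  using assms
proof (induction k arbitrary: h a \<alpha> x)
  case (Suc k h a \<alpha> x)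
  define n where "n = length w"
  \<comment> \<open>A pass takes \<open>n + 1\<close> reads and one step at the right end, each with
    a factor 1/64; with \<open>n + 1\<close> lossless steps of rewinding this makes
    \<open>2 * n + 3\<close> steps.\<close>
  define B where "B = (a / 64 ^ (Suc k * (n + 2)))\<^sup>2"
  define m where "m = k * (2 * n + 3) + Suc n"
  have B_le: "B \<le> (a / 64 ^ Suc n / 64)\<^sup>2"
  proof -
    have "\<bar>a\<bar> / 64 ^ (Suc k * (n + 2)) \<le> \<bar>a\<bar> / 64 ^ (n + 2)"
      by (intro divide_left_mono power_increasing) auto
    then have "\<bar>a / 64 ^ (Suc k * (n + 2))\<bar> \<le> \<bar>a / 64 ^ Suc n / 64\<bar>"
      by (simp add: abs_divide power_add field_simps)
    then show ?thesis unfolding B_def by (simp only: abs_le_square_iff)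
  qed
  have "B \<le> halt_within (Suc m + Suc n) h"
  proof (rule read_halt_within)
    show "lossy h" "in_step h 0" "Suc n = Suc (length w) - pos h"
      using Suc.prems by (simp_all add: lossy_def in_step_def n_def)
    show "amp h = register a (\<alpha> - t) (real x) (real 0)" using Suc.prems(3) by simp
  next
    fix h' y
    assume h': "pos h' = Suc (length w)" "state h' = 1 \<or> state h' = 2"
      "amp h' = register (a / 64 ^ Suc n) (\<alpha> - t) (real x) (real y)" "in_step h' y"
    have running: "\<not> halted h'" using h'(2) by auto
    have p: "length w < pos h'" using h'(1) by simp
    \<comment> \<open>In turn: acceptance has amplitude 1 up to scaling; a wrong number is rejected
      with amplitude at least 1; a correct number other than \<open>word_num w\<close> leaves fewer
      passes to go.\<close>
    consider "state h' = 1" | "state h' = 2" "y \<noteq> Suc x" | "state h' = 2" "y = Suc x"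
      using h'(2) by blast
    then show "B \<le> halt_within (Suc m) h'"
    proof cases
      case 1
      note d = decide_step[OF 1 p h'(3)]
      have "B \<le> halt_within m (0 # h')"
        using B_le d(1) by (subst halt_within_halted) (simp_all add: d(2))
      then show ?thesis using halt_within_Cons[OF running, of m 0] by linarith
    next
      case 2
      note d = advance_step[OF 2(1) p h'(3)]
      have "1 \<le> \<bar>real y - real x - 1\<bar>" using 2(2) by linarith
      then have "1 \<le> (real y - real x - 1)\<^sup>2"
        using power_mono[of 1 "\<bar>real y - real x - 1\<bar>" 2] by simp
      then have "(a / 64 ^ Suc n / 64)\<^sup>2 * 1 \<le> (norm (amp (1 # h')))\<^sup>2"
        unfolding d(5) by (rule mult_left_mono) simp
      then have "B \<le> halt_within m (1 # h')"
        using B_le d(4) by (subst halt_within_halted) simp_all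
      then show ?thesis using halt_within_Cons[OF running, of m 1] by linarith
    next
      case 3
      note d = advance_step[OF 3(1) p h'(3)]
      have "Suc x \<noteq> word_num w" using in_step_end(2)[OF h'(4,1)] 3 by simp
      then have "0 < k" "word_num w = Suc x + k" using Suc.prems(4) by auto
      note IH = Suc.IH[OF _ _ _ this(2) this(1)]
      have "B \<le> halt_within (k * (2 * n + 3) + pos (0 # h')) (0 # h')"
      proof (rule rewind_halt_within[OF d(1)])
        fix h''
        assume h'': "state h'' = 0" "pos h'' = 0" "amp h'' = amp (0 # h')"
        have "amp h'' = register (a / 64 ^ Suc n / 64) ((4 * \<alpha> - P w h') - t) (real (Suc x)) 0"
          using h''(3) d(3) by (simp add: add.commute)
        from IH[OF h''(1,2) this]
        have "(a / 64 ^ Suc n / 64 / 64 ^ (k * (n + 2)))\<^sup>2 \<le> halt_within (k * (2 * n + 3)) h''"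
          by (simp add: n_def)
        also have "a / 64 ^ Suc n / 64 / 64 ^ (k * (n + 2)) = a / 64 ^ (Suc k * (n + 2))"
          by (simp add: power_add)
        finally show "B \<le> halt_within (k * (2 * n + 3)) h''" by (simp only: B_def)
      qed
      moreover have "pos (0 # h') = Suc n" using d(2) h'(1) n_def by simp
      ultimately have "B \<le> halt_within m (0 # h')" by (simp add: m_def)
      then show ?thesis using halt_within_Cons[OF running, of m 0] by linarith
    qed
  qed
  moreover have "Suc m + Suc n = Suc k * (2 * n + 3)" by (simp add: m_def)
  ultimately show ?case by (simp only: B_def n_def)
qed simp

text \<open>The halting mass guaranteed after a restart of unit mass, from
  \<open>passes_halt_within\<close> with \<open>a = 1\<close> and \<open>x = 0\<close>.\<close>

definition pass_bound :: real where
  "pass_bound = (1 / 64 ^ (word_num w * (length w + 2)))\<^sup>2"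

lemma pass_bound: "0 < pass_bound" "pass_bound \<le> 1"
proof -
  have "(1 :: real) \<le> 64 ^ (word_num w * (length w + 2))" by (rule one_le_power) simp
  then show "pass_bound \<le> 1" unfolding pass_bound_def by (intro power_le_one) simp_all
qed (simp add: pass_bound_def)

lemma restart_halt_within:
  assumes "state h = 0" "amp h = register a 0 0 0"
  shows "pass_bound * a\<^sup>2 \<le> halt_within (word_num w * (2 * length w + 3) + Suc (length w)) h"
proof -
  let ?m = "word_num w * (2 * length w + 3)"
  have "pass_bound * a\<^sup>2 \<le> halt_within (?m + pos h) h"
  proof (rule rewind_halt_within[OF assms(1)])
    fix h' assume h': "state h' = 0" "pos h' = 0" "amp h' = amp h"
    have "0 < word_num w" using word_num_pos[of w] by simp
    moreover have "amp h' = register a (t - t) (real 0) 0" using h'(3) assms(2) by simp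
    ultimately show "pass_bound * a\<^sup>2 \<le> halt_within ?m h'"
      using passes_halt_within[OF h'(1,2), of a t 0 "word_num w"]
      by (simp add: pass_bound_def power_divide)
  qed
  also have "\<dots> \<le> halt_within (?m + Suc (length w)) h"
    using control_bounds[of h] by (intro halt_within_mono) simp
  finally show ?thesis .
qed

lemma norm_first_outcome:
  assumes "lossy h"
  shows "(norm (amp (0 # h)))\<^sup>2 \<le> (norm (amp h))\<^sup>2 / 4"
proof -
  have c: "0 \<le> real (P w h)" "real (P w h) \<le> 1" and "0 \<le> t" "t \<le> 1/3"
    using message_le[of h] membership_real_nonneg membership_real_le by (simp_all add: t_eq)
  note e = op_entries[OF this]
  have "\<exists>E. amp (0 # h) = E *v amp h \<and> (\<forall>i j. \<bar>E $ i $ j\<bar> \<le> 1/8)"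
    using assms e by (auto simp: amp_lossy word_ops_def restart_completion_nth lossy_def)
  then show ?thesis using norm_mult_le by metis
qed

text \<open>Within a round the counters may dominate the norm, and a bound in terms of
  \<open>a\<close> says little about it. But outcome 0 keeps at most a quarter of the mass, and
  every other outcome halts at once or restarts, where \<open>pass_bound\<close> applies.\<close>

lemma lossy_halt_within:
  assumes "lossy h"
  defines "m \<equiv> word_num w * (2 * length w + 3) + Suc (length w)"
  shows "3/4 * pass_bound * (norm (amp h))\<^sup>2 \<le> halt_within (Suc m) h"
proof -
  have running: "\<not> halted h" using assms by (auto simp: lossy_def)
  have split: "(\<Sum>i<18. f i) = f 0 + (\<Sum>i\<in>{1..<18}. f i)" for f :: "nat \<Rightarrow> real"
    by (simp add: lessThan_atLeast0 sum.atLeast_Suc_lessThan)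
  have "pass_bound * (norm (amp (i # h)))\<^sup>2 \<le> halt_within m (i # h)" if "i \<noteq> 0" for i
  proof (cases "length w < pos h \<and> i = 1")
    case True
    then have "state (i # h) = 4" using assms(1) by (auto simp: step_simps lossy_def)
    then have "halt_within m (i # h) = (norm (amp (i # h)))\<^sup>2" by (intro halt_within_halted) simp
    then show ?thesis using pass_bound by (simp add: mult_left_le_one_le)
  next
    case False
    with restart_step[OF assms(1) that] obtain a
      where "state (i # h) = 0" "amp (i # h) = register a 0 0 0" by blast
    then show ?thesis using restart_halt_within[of "i # h" a] by (simp add: m_def norm_restart)
  qed
  then have "(\<Sum>i\<in>{1..<18}. pass_bound * (norm (amp (i # h)))\<^sup>2) \<le> (\<Sum>i\<in>{1..<18}. halt_within m (i # h))"
    by (intro sum_mono) simp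
  also have "\<dots> \<le> halt_within (Suc m) h"
    using halt_within_nonneg[of m "0 # h"] unfolding halt_within_Suc[OF running] split by simp
  finally have "pass_bound * (\<Sum>i\<in>{1..<18}. (norm (amp (i # h)))\<^sup>2) \<le> halt_within (Suc m) h"
    by (simp only: sum_distrib_left)
  moreover have "3/4 * (norm (amp h))\<^sup>2 \<le> (\<Sum>i\<in>{1..<18}. (norm (amp (i # h)))\<^sup>2)"
    using sum_amp_Cons[OF running] norm_first_outcome[OF assms(1)] unfolding split by linarith
  then have "pass_bound * (3/4 * (norm (amp h))\<^sup>2) \<le>
      pass_bound * (\<Sum>i\<in>{1..<18}. (norm (amp (i # h)))\<^sup>2)"
    using pass_bound by (intro mult_left_mono) simp_all
  ultimately show ?thesis by simp
qed

text \<open>A rewind, one lossy step and a second rewind account for the additional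
  \<open>2 * length w + 3\<close> steps.\<close>

lemma eventually_halts:
  assumes "\<not> halted h"
  shows "3/4 * pass_bound * (norm (amp h))\<^sup>2 \<le>
    halt_within (Suc (word_num w) * (2 * length w + 3)) h"
proof -
  define m where "m = Suc (word_num w * (2 * length w + 3) + Suc (length w))"
  have m: "Suc (word_num w) * (2 * length w + 3) = m + Suc (length w)" by (simp add: m_def)
  show ?thesis
  proof (cases "lossy h")
    case True
    then have "3/4 * pass_bound * (norm (amp h))\<^sup>2 \<le> halt_within m h"
      using lossy_halt_within m_def by simp
    also have "\<dots> \<le> halt_within (m + Suc (length w)) h" by (rule halt_within_mono) simp
    finally show ?thesis by (simp only: m)
  next
    case False
    then have "state h = 0" using assms control_bounds[of h] by (auto simp: lossy_def)
    then have "3/4 * pass_bound * (norm (amp h))\<^sup>2 \<le> halt_within (m + pos h) h"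
    proof (rule rewind_halt_within)
      fix h' assume "state h' = 0" "pos h' = 0" "amp h' = amp h"
      then show "3/4 * pass_bound * (norm (amp h))\<^sup>2 \<le> halt_within m h'"
        using lossy_halt_within[of h'] m_def by (simp add: lossy_def)
    qed
    also have "\<dots> \<le> halt_within (m + Suc (length w)) h"
      using control_bounds[of h] by (intro halt_within_mono) simp
    finally show ?thesis by (simp only: m)
  qed
qed

lemma accept_plus_reject_word: "accept_prob (word_verifier t) P w + reject_prob (word_verifier t) P w = 1"
  and expected_runtime_word: "expected_runtime (word_verifier t) P w \<le>
    ennreal (real (Suc (word_num w) * (2 * length w + 3)) / (3/4 * pass_bound))"
proof -
  have "0 < 3/4 * pass_bound" using pass_bound by simp
  note * = this eventually_halts
  show "accept_prob (word_verifier t) P w + reject_prob (word_verifier t) P w = 1"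
    by (rule accept_plus_reject_eq_1[OF *])
  show "expected_runtime (word_verifier t) P w \<le>
    ennreal (real (Suc (word_num w) * (2 * length w + 3)) / (3/4 * pass_bound))"
    by (rule expected_runtime_le[OF *])
qed

end

section \<open>The honest prover\<close>

text \<open>The prover reads the number of the current pass off the register: the ratio of two components
  is not affected by the normalisation.\<close>

fun honest_message :: "bool list set \<Rightarrow> bool list \<Rightarrow> (nat, 4) config \<Rightarrow> nat" where
  "honest_message L w (s, p, \<psi>) =
     (let j = Suc (nat \<lfloor>\<psi> $ 3 / \<psi> $ 1\<rfloor>)
      in if p \<le> length w then j div 2 ^ (length w - p) mod 2 else membership_digit L j)"

text \<open>A prover is given only outcomes, so it replays the run with its own earlier messages;
  the separate recursion avoids circularity with \<open>config_after\<close>.\<close>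

primrec honest_config ::
  "bool list set \<Rightarrow> (nat, nat, bool, 4) verifier \<Rightarrow> bool list \<Rightarrow> nat list \<Rightarrow> (nat, 4) config" where
  "honest_config L V w [] = init_config V"
| "honest_config L V w (i # h) =
     next_config V w (honest_message L w (honest_config L V w h)) (honest_config L V w h) i"

definition honest_prover :: "bool list set \<Rightarrow> (nat, nat, bool, 4) verifier \<Rightarrow> (bool, nat) prover" where
  "honest_prover L V w h = honest_message L w (honest_config L V w h)"

lemma config_after_honest: "config_after V (honest_prover L V) w h = honest_config L V w h"
  by (induction h) (simp_all add: honest_prover_def)

lemma honest_message_le: "honest_message L w C \<le> 1"
  by (cases C) (auto simp: Let_def membership_digit_def)

lemma prover_for_honest: "prover_for (word_verifier t) (honest_prover L V)"
proof -
  have "honest_message L w C \<in> {0, 1}" for w C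
    using honest_message_le[of L w C] by auto
  then show ?thesis by (simp only: prover_for_def honest_prover_def word_verifier_simps) blast
qed

locale honest_run = word_run +
  assumes P_eq: "P = honest_prover L (word_verifier t)"
begin

lemma message_eq:
  assumes "amp h = register a \<beta> (real x) y" "amp h \<noteq> 0"
  shows "P w h = (if pos h \<le> length w then Suc x div 2 ^ (length w - pos h) mod 2
    else membership_digit L (Suc x))"
proof -
  define \<psi> where "\<psi> = snd (snd (config_after (word_verifier t) P w h))"
  have "P w h = honest_message L w (config_after (word_verifier t) P w h)"
    by (simp only: P_eq config_after_honest) (simp only: honest_prover_def)
  also have "config_after (word_verifier t) P w h = (state h, pos h, \<psi>)"
    unfolding \<psi>_def by (rule config_after_eq)
  finally have P: "P w h = honest_message L w (state h, pos h, \<psi>)" .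
  have amp: "amp h = norm (amp h) *\<^sub>R \<psi>"
    using amp_normalised[of h] assms(2) by (auto simp: \<psi>_def)
  have "a \<noteq> 0" using assms by auto
  have "a = norm (amp h) * \<psi> $ 1" "a * x = norm (amp h) * \<psi> $ 3"
    using arg_cong[OF amp, of "\<lambda>v. v $ 1"] arg_cong[OF amp, of "\<lambda>v. v $ 3"]
    by (simp_all add: assms(1) register_def)
  then have "\<psi> $ 3 = real x * \<psi> $ 1" "\<psi> $ 1 \<noteq> 0"
    using assms(2) \<open>a \<noteq> 0\<close> by (auto simp: algebra_simps)
  then have "\<psi> $ 3 / \<psi> $ 1 = real x" by simp
  then show ?thesis by (simp add: P)
qed

text \<open>Under the honest prover the encoding is shifted correctly, the bits received are the
  leading ones of \<open>Suc x\<close> written with \<open>length w + 1\<close> digits, and pass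
  \<open>word_num w\<close> is never exceeded. Zero vectors are set apart, since no pass number can
  be read off them.\<close>

definition on_track :: "nat list \<Rightarrow> bool" where
  "on_track h \<longleftrightarrow> state h < 3 \<longrightarrow> amp h \<noteq> 0 \<longrightarrow> (\<exists>a x y.
     amp h = register a (membership_real L (Suc x) - t) (real x) (real y) \<and> in_step h y \<and>
     Suc x \<le> word_num w \<and> (lossy h \<longrightarrow> y = Suc x div 2 ^ (Suc (length w) - pos h)))"

lemma on_trackI:
  assumes "amp h = register a (membership_real L (Suc x) - t) (real x) (real y)" "in_step h y"
    "Suc x \<le> word_num w" "lossy h \<Longrightarrow> y = Suc x div 2 ^ (Suc (length w) - pos h)"
  shows "on_track h"
  using assms unfolding on_track_def by blast

lemma on_track_start:
  assumes "amp h = register a (membership_real L (Suc x) - t) (real x) 0" "state h = 0"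
    "Suc x \<le> word_num w"
  shows "on_track h"
proof (rule on_trackI)
  show "amp h = register a (membership_real L (Suc x) - t) (real x) (real 0)"
    using assms(1) by simp
  have "Suc x < 2 ^ Suc (length w)" using assms(3) word_num_less[of w] by simp
  then show "0 = Suc x div 2 ^ (Suc (length w) - pos h)" if "lossy h"
    using that assms(2) by (simp add: lossy_def)
qed (use assms in \<open>simp_all add: in_step_def\<close>)

lemma on_track_restart:
  assumes "amp h = register a 0 0 0" "state h = 0"
  shows "on_track h"
  using assms word_num_pos[of w] t_eq by (intro on_track_start[of h a 0]) simp_all

lemma on_track: "on_track h"
proof (induction h)
  case Nil
  show ?case
    by (rule on_track_restart[of _ 1]) (simp_all add: axis_register state_Nil del: config_after.simps)
next
  case (Cons i h)
  show ?case
  proof (cases "amp (i # h) = 0 \<or> 3 \<le> state (i # h)")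
    case True
    then show ?thesis by (auto simp: on_track_def)
  next
    case False
    then have "\<not> halted h" and nz: "amp h \<noteq> 0"
      by (auto simp: amp.simps split: if_splits)
    then have "state h < 3" using control_bounds[of h] by auto
    then obtain a x y
      where amp: "amp h = register a (membership_real L (Suc x) - t) (real x) (real y)"
        and y: "in_step h y" and x: "Suc x \<le> word_num w"
        and y_eq: "lossy h \<Longrightarrow> y = Suc x div 2 ^ (Suc (length w) - pos h)"
      using Cons nz unfolding on_track_def by blast
    note P = message_eq[OF amp nz]
    show ?thesis
      using \<open>state h < 3\<close>
    proof (cases rule: history_cases)
      case 1
      with False have "i = 0" by (auto simp: amp.simps word_ops_def split: if_splits)
      moreover have "y = 0" using y 1 by (simp add: in_step_def)
      ultimately show ?thesis using amp x rewind_step[OF 1]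
        by (intro on_track_start[of _ a x]) simp_all
    next
      case 2
      show ?thesis
      proof (cases "i = 0")
        case True
        define m where "m = length w - pos h"
        have "Suc (length w) - pos h = Suc m" using 2(2) by (simp add: m_def)
        then have "y = Suc x div 2 ^ m div 2" and "P w h = Suc x div 2 ^ m mod 2"
          using y_eq[OF 2(1)] P 2(2)
          by (simp_all add: m_def div_mult2_eq[symmetric] mult.commute)
        then have "2 * y + P w h = Suc x div 2 ^ m" by simp
        moreover have "Suc (length w) - pos (0 # h) = m" using read_step(2)[OF 2] by (simp add: m_def)
        moreover have "amp (0 # h) =
            register (a / 64) (membership_real L (Suc x) - t) (real x) (real (2 * y + P w h))"
          using read_step(4)[OF 2 amp] by simp
        ultimately show ?thesis
          unfolding True using read_step(3)[OF 2 y] x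
          by (intro on_trackI[of _ "a / 64" x "2 * y + P w h"]) simp_all
      next
        case False
        then show ?thesis using restart_step[of h i] 2 on_track_restart by auto
      qed
    next
      case 3
      then have "i \<noteq> 0" "i \<noteq> 1" using False by (auto simp: step_simps split: if_splits)
      then show ?thesis using restart_step[of h i] 3 on_track_restart by (auto simp: lossy_def)
    next
      case 4
      show ?thesis
      proof (cases "i = 0")
        case True
        have "lossy h" using 4 by (simp add: lossy_def)
        then have "y = Suc x" using y_eq 4(2) by simp
        \<comment> \<open>State 2 at the right end shows that this pass is not yet number
          \<open>word_num w\<close>.\<close>
        then have "Suc (Suc x) \<le> word_num w" using in_step_end(2)[OF y 4(2,1)] x by simp
        moreover have "amp (0 # h) =
            register (a / 64) (membership_real L (Suc (Suc x)) - t) (real (Suc x)) 0"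
          using advance_step(3)[OF 4(1) _ amp] 4(2) P membership_real_Suc[of L "Suc x"]
          by (simp add: add.commute)
        ultimately show ?thesis
          unfolding True using advance_step(1)[OF 4(1) _ amp] 4(2)
          by (intro on_track_start[of _ "a / 64" "Suc x"]) simp_all
      next
        case i: False
        then have "i \<noteq> 1" using 4 False by (auto simp: step_simps)
        then show ?thesis using restart_step[of h i] i 4 on_track_restart by (auto simp: lossy_def)
      qed
    qed
  qed
qed

text \<open>With a correct pass number \<open>mismatch_op\<close> has amplitude 0, so a possible
  rejection comes from \<open>refute_op\<close>. The digit of \<open>w\<close> being 1, its weight
  is 4 times the square of a tail, at most 4/9 of that of \<open>accept_op\<close>.\<close>

lemma refute_member:
  assumes "w \<in> L" "state (1 # h) = 4" "history_prob (word_verifier t) P w (1 # h) \<noteq> 0"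
  shows "state h = 1 \<and> pos h = Suc (length w) \<and>
    9/4 * history_prob (word_verifier t) P w (1 # h) \<le> history_prob (word_verifier t) P w (0 # h)"
proof -
  have p: "pos h = Suc (length w)" "length w < pos h" using rejecting_history[OF assms(2)] by simp_all
  have nz: "amp h \<noteq> 0" "amp (1 # h) \<noteq> 0" and "\<not> halted h"
    using assms(3) by (auto simp: amp_normalised(2) amp.simps split: if_splits)
  then have "state h < 3" using control_bounds[of h] by auto
  then obtain a x y
    where amp: "amp h = register a (membership_real L (Suc x) - t) (real x) (real y)"
      and y: "in_step h y" and y_eq: "lossy h \<Longrightarrow> y = Suc x div 2 ^ (Suc (length w) - pos h)"
    using on_track[of h] nz unfolding on_track_def by blast
  have "state h \<noteq> 0" using assms(2) p by (auto simp: step_simps split: if_splits)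
  with \<open>state h < 3\<close> have "lossy h" by (simp add: lossy_def)
  then have "y = Suc x" using y_eq p by simp
  have "state h \<noteq> 2"
  proof
    assume "state h = 2"
    then have "(norm (amp (1 # h)))\<^sup>2 = 0"
      using advance_step(5)[OF _ p(2) amp] \<open>y = Suc x\<close> by simp
    then show False using nz by simp
  qed
  with \<open>state h < 3\<close> \<open>state h \<noteq> 0\<close> have one: "state h = 1" by simp
  define e where "e = membership_real L (Suc (Suc x))"
  have "Suc x = word_num w" using in_step_end(1)[OF y p(1) one] \<open>y = Suc x\<close> by simp
  then have "4 * membership_real L (Suc x) = 1 + e"
    using membership_real_Suc[of L "Suc x"] membership_digit_word[of L w] assms(1)
    by (simp add: e_def)
  then have reject_norm: "(norm (amp (1 # h)))\<^sup>2 = (a / 64)\<^sup>2 * (4 * e\<^sup>2)"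
    using decide_step(4)[OF one p(2) amp] \<open>y = Suc x\<close> by simp
  have "0 \<le> e" "e \<le> 1/3" unfolding e_def by (rule membership_real_nonneg, rule membership_real_le)
  then have "e\<^sup>2 \<le> (1/3)\<^sup>2" by (intro power_mono)
  then have "9/4 * (4 * e\<^sup>2) \<le> 1" by (simp add: power2_eq_square)
  then have "(a / 64)\<^sup>2 * (9/4 * (4 * e\<^sup>2)) \<le> (a / 64)\<^sup>2 * 1"
    by (rule mult_left_mono) simp
  then have "9/4 * (norm (amp (1 # h)))\<^sup>2 \<le> (norm (amp (0 # h)))\<^sup>2"
    unfolding reject_norm decide_step(2)[OF one p(2) amp] by (simp only: mult.left_commute mult_1_right)
  then show ?thesis using one p by (simp only: amp_normalised(2))
qed

lemma accept_member:
  assumes "w \<in> L"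
  shows "ennreal (9/4) * reject_prob (word_verifier t) P w \<le> accept_prob (word_verifier t) P w"
  unfolding accept_prob_def reject_prob_def
\<comment> \<open>Rejections of probability zero stay outside \<open>A\<close>: those by
  \<open>mismatch_op\<close> have no accepting counterpart.\<close>
proof (rule infsum_ennreal_le_reindex[where \<phi> = "\<lambda>h. 0 # tl h"
      and A = "{h. state h = 4 \<and> history_prob (word_verifier t) P w h \<noteq> 0}"])
  let ?A = "{h. state h = 4 \<and> history_prob (word_verifier t) P w h \<noteq> 0}"
  have decision: "\<exists>h'. h = 1 # h'" if "state h = 4" for h
    using that rejecting_history by (cases h) (auto simp: state_Nil simp del: config_after.simps)
  show "inj_on (\<lambda>h. 0 # tl h) ?A"
    by (auto simp: inj_on_def dest!: decision)
  have acc: "state (0 # tl h) = 3 \<and> 9/4 * history_prob (word_verifier t) P w h \<le>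
      history_prob (word_verifier t) P w (0 # tl h)" if h: "h \<in> ?A" for h
  proof -
    obtain h' where h': "h = 1 # h'" using decision[of h] h by auto
    then have "state h' = 1 \<and> pos h' = Suc (length w) \<and>
        9/4 * history_prob (word_verifier t) P w h \<le> history_prob (word_verifier t) P w (0 # h')"
      using refute_member[OF assms, of h'] h by blast
    then show ?thesis by (simp add: h' step_simps)
  qed
  show "(\<lambda>h. 0 # tl h) ` ?A \<subseteq> {h. state h = acc_state (word_verifier t)}"
    using acc by (simp only: image_subset_iff mem_Collect_eq word_verifier_simps) blast
  show "ennreal (9/4) * ennreal (history_prob (word_verifier t) P w h) \<le>
      ennreal (history_prob (word_verifier t) P w (0 # tl h))" if "h \<in> ?A" for h
    using acc[OF that] by (simp add: history_prob_nonneg ennreal_leI flip: ennreal_mult)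
qed auto

end

section \<open>From odds to the error bound\<close>

text \<open>The odds give \<open>q\<close> a share of at least 16/25, which exceeds 3/5; almost sure
  halting turns odds into probabilities.\<close>

lemma majority:
  fixes p q :: ennreal
  assumes sum: "p + q = 1" and le: "ennreal (16/9) * p \<le> q"
  shows "ennreal (1 - 2/5) \<le> q"
proof -
  have "p \<le> p + q" "q \<le> p + q" by simp_all
  then have "p \<noteq> top" "q \<noteq> top" unfolding sum by (auto simp: top_unique)
  then obtain x y where x: "p = ennreal x" "0 \<le> x" and y: "q = ennreal y" "0 \<le> y"
    by (cases p; cases q) auto
  have "ennreal (x + y) = ennreal 1" using sum x y by simp
  then have "x + y = 1" using x y by (subst (asm) ennreal_inj) simp_all
  moreover have "ennreal (16/9 * x) \<le> ennreal y"
    using le x y by (subst ennreal_mult) simp_all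
  then have "16/9 * x \<le> y" using y by (subst (asm) ennreal_le_iff) simp_all
  ultimately show ?thesis unfolding y by (intro ennreal_leI) simp
qed

theorem theorem3:
  fixes L :: "bool list set"
  shows "\<exists>V :: (nat, nat, bool, 4) verifier.
    twoway_qcfa_verifier V \<and>
    recognizes_with_bounded_error V L \<and>
    (\<exists>f :: nat \<Rightarrow> real. f \<in> O(\<lambda>n. real n) \<and>
      (\<forall>w P. prover_for V P \<longrightarrow>
        expected_runtime V P w \<le> ennreal (2 powr (2 powr f (length w)))))"
proof (intro exI conjI)
  define t where "t = membership_real L 1"
  let ?V = "word_verifier t"
  show "twoway_qcfa_verifier ?V"
    unfolding t_def by (rule twoway_qcfa_word_verifier[OF membership_real_nonneg membership_real_le])
  have run: "word_run L P t" if "prover_for ?V P" for P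
    using that by unfold_locales (simp_all add: t_def)
  show "recognizes_with_bounded_error ?V L"
    unfolding recognizes_with_bounded_error_def
  proof (intro exI[of _ "2/5"] conjI ballI allI impI)
    fix w assume w: "w \<in> L"
    let ?P = "honest_prover L ?V"
    have P: "prover_for ?V ?P" by (rule prover_for_honest)
    have honest: "honest_run L ?P t"
      using run[OF P] by (simp add: honest_run_def honest_run_axioms_def)
    \<comment> \<open>The honest odds 9/4 exceed 16/9, so one error bound serves both
      directions.\<close>
    have "ennreal (16/9) * reject_prob ?V ?P w \<le> ennreal (9/4) * reject_prob ?V ?P w"
      by (intro mult_right_mono ennreal_leI) simp_all
    also note honest_run.accept_member[OF honest w]
    finally have "ennreal (1 - 2/5) \<le> accept_prob ?V ?P w"
      using word_run.accept_plus_reject_word[OF run[OF P], of w]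
      by (intro majority) (simp_all add: add.commute)
    then show "\<exists>P. prover_for ?V P \<and> ennreal (1 - 2/5) \<le> accept_prob ?V P w"
      using P by blast
  next
    fix w P assume w: "w \<notin> L" and P: "prover_for ?V P"
    show "ennreal (1 - 2/5) \<le> reject_prob ?V P w"
      using word_run.accept_plus_reject_word[OF run[OF P]] word_run.reject_non_member[OF run[OF P] w]
      by (rule majority)
  qed simp_all
  show "(\<lambda>n. 2 * real n + 6) \<in> O(\<lambda>n. real n)"
    by (rule bigoI[of _ 8]) (auto simp: eventually_sequentially intro: exI[of _ 1])
  show "\<forall>w P. prover_for ?V P \<longrightarrow>
      expected_runtime ?V P w \<le> ennreal (2 powr (2 powr (2 * real (length w) + 6)))"
  proof (intro allI impI)
    fix w P assume P: "prover_for ?V P"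
    show "expected_runtime ?V P w \<le> ennreal (2 powr (2 powr (2 * real (length w) + 6)))"
      using word_run.expected_runtime_word[OF run[OF P], of w]
        double_exponential_bound[OF word_num_less[of w]]
      unfolding word_run.pass_bound_def[OF run[OF P]]
      by (meson ennreal_leI order_trans)
  qed
qed

end
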